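(* Let $n\ge1$ and let $\mathcal C_X$ be the two-qubit CNOT channel, with Alice holding the target qubit and Bob the control qubit. Write $\bar B=B^{\otimes n}$ and $\bar B'=B'^{\otimes n}$ for Bob's input and output systems of $\mathcal C_X^{\otimes n}$, so that $d_{\bar B'}=2^n$. Then $$\Sigma(\mathcal C_X^{\otimes n})=\frac{2(d_{\bar B'}-1)}{d_{\bar B'}}=\frac{2(2^n-1)}{2^n}.$$ Moreover, in the expression $$\Sigma(\mathcal C_X^{\otimes n})=\max_{\rho\in\mathsf{St}(E\bar B)}\big\|[\mathcal I_{E\bar B}-\mathcal I_E\otimes\mathcal M^{\otimes n}](\rho)\big\|_1\qquad(E\cong\bar B),$$ where $\mathcal M:\rho\mapsto P_0\rho P_0+P_1\rho P_1$ is the qubit measurement channel in the computational basis ($P_i=|i\rangle\langle i|$), the maximum is achieved by any maximally entangled state $\rho$ of $E\bar B$.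
   Context: All systems are finite-dimensional quantum systems; system $X$ has complex Hilbert space $\mathcal H_X$ of dimension $d_X$, and the composite system $XY$ has Hilbert space $\mathcal H_X\otimes\mathcal H_Y$. $\mathsf{St}(X)$ is the set of density operators on $\mathcal H_X$. $\mathfrak C(X,Y)$ is the set of quantum channels (completely positive trace-preserving linear maps) from operators on $\mathcal H_X$ to operators on $\mathcal H_Y$. $\mathcal I_X$ is the identity channel on $X$. $\|X\|_1=\mathrm{Tr}\sqrt{X^\dagger X}$. For a Hermitian-preserving linear map $\mathcal L$ with input system $X$, the diamond norm is $\|\mathcal L\|_\diamond=\sup_{\rho\in\mathsf{St}(EX)}\|(\mathcal I_E\otimes\mathcal L)(\rho)\|_1$ with $E\cong X$. A maximally entangled state of $E\bar B$ with $E\cong \bar B$ is a pure state whose marginals are maximally mixed. For a bipartite unitary channel $\mathcal U:\rho\mapsto U\rho U^\dagger$ with $U:\mathcal H_A\otimes\mathcal H_B\to\mathcal H_{A'}\otimes\mathcal H_{B'}$ unitary, the signalling of $\mathcal U$ (from $A$ to $B'$) is $$\Sigma(\mathcal U)=\inf_{\mathcal C\in\mathfrak C(B,B')}\|(\mathrm{Tr}_{A'}\otimes\mathcal I_{B'})\circ\mathcal U-\mathrm{Tr}_A\otimes\mathcal C\|_\diamond .$$ The CNOT gate is the unitary on $\mathbb C^2\otimes\mathbb C^2$ with $\mathrm{CNOT}(|a\rangle\otimes|b\rangle)=|a\oplus b\rangle\otimes|b\rangle$ for $a,b\in\{0,1\}$ ($\oplus$ is addition modulo 2), and $\mathcal C_X:\rho\mapsto\mathrm{CNOT}\,\rho\,\mathrm{CNOT}$.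 Alice's input $A$ and output $A'$ are the first (target) qubit and Bob's input $B$ and output $B'$ are the second (control) qubit. $\mathcal C_X^{\otimes n}$ is regarded as a bipartite unitary channel with Alice's input $A^{\otimes n}$ and output $A'^{\otimes n}$, and Bob's input $B^{\otimes n}$ and output $B'^{\otimes n}$. *)

theory Defs
  imports "HOL-Analysis.Analysis"
begin

section \<open>Operators and states\<close>

text \<open>
  A finite-dimensional system with an orthonormal basis indexed by a finite type \<open>'x\<close> has Hilbert
  space \<open>complex ^ 'x\<close> and dimension \<open>CARD('x)\<close>.  Operators are matrices in that basis, and the
  composite of the systems \<open>'x\<close> and \<open>'y\<close> is the system \<open>'x \<times> 'y\<close>, with the product basis.
\<close>

type_synonym 'x operator = "((complex, 'x) vec, 'x) vec"

definition sesq :: "complex ^ 'x \<Rightarrow> complex ^ 'x \<Rightarrow> complex" where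
  "sesq v w = (\<Sum>i\<in>UNIV. cnj (v $ i) * w $ i)"

definition dagger :: "'x::finite operator \<Rightarrow> 'x operator" where
  "dagger A = (\<chi> i j. cnj (A $ j $ i))"

definition op_scale :: "complex \<Rightarrow> 'x::finite operator \<Rightarrow> 'x operator" where
  "op_scale c A = (\<chi> i j. c * A $ i $ j)"

definition ketbra :: "complex ^ 'x \<Rightarrow> complex ^ 'x \<Rightarrow> 'x::finite operator" where
  "ketbra v w = (\<chi> i j. v $ i * cnj (w $ j))"

text \<open>Over the complex numbers this condition includes that \<open>A\<close> is Hermitian.\<close>

definition psd :: "'x::finite operator \<Rightarrow> bool" where
  "psd A \<longleftrightarrow> (\<forall>v. sesq v (A *v v) \<in> \<real>\<^sub>\<ge>\<^sub>0)"

definition psd_sqrt :: "'x::finite operator \<Rightarrow> 'x operator" where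
  "psd_sqrt A = (THE S. psd S \<and> S ** S = A)"

definition trace_norm :: "'x::finite operator \<Rightarrow> real" where
  "trace_norm A = Re (trace (psd_sqrt (dagger A ** A)))"

definition states :: "'x::finite operator set" where
  "states = {\<rho>. psd \<rho> \<and> trace \<rho> = 1}"

definition pure_state :: "'x::finite operator \<Rightarrow> bool" where
  "pure_state \<rho> \<longleftrightarrow> (\<exists>\<psi>. sesq \<psi> \<psi> = 1 \<and> \<rho> = ketbra \<psi> \<psi>)"

definition max_mixed :: "'x::finite operator" where
  "max_mixed = mat (1 / of_nat CARD('x))"

definition ptrace_fst :: "('x::finite \<times> 'y::finite) operator \<Rightarrow> 'y operator" where
  "ptrace_fst \<rho> = (\<chi> y y'. \<Sum>x\<in>UNIV. \<rho> $ (x, y) $ (x, y'))"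

definition ptrace_snd :: "('x::finite \<times> 'y::finite) operator \<Rightarrow> 'x operator" where
  "ptrace_snd \<rho> = (\<chi> x x'. \<Sum>y\<in>UNIV. \<rho> $ (x, y) $ (x', y))"

definition maximally_entangled :: "('x::finite \<times> 'x) operator \<Rightarrow> bool" where
  "maximally_entangled \<rho> \<longleftrightarrow>
     pure_state \<rho> \<and> ptrace_fst \<rho> = max_mixed \<and> ptrace_snd \<rho> = max_mixed"


section \<open>Channels\<close>

text \<open>
  For every ancilla dimension \<open>k\<close>, an operator on the composite of the ancilla with \<open>'x\<close> is a
  \<open>k \<times> k\<close> array \<open>R i j\<close> (for \<open>i, j < k\<close>) of operators on \<open>'x\<close>, and a vector is a family \<open>v i\<close>
  (for \<open>i < k\<close>).  Tensoring \<open>F\<close> with the identity of the ancilla applies \<open>F\<close> blockwise.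
\<close>

definition block_psd :: "nat \<Rightarrow> (nat \<Rightarrow> nat \<Rightarrow> 'x::finite operator) \<Rightarrow> bool" where
  "block_psd k R \<longleftrightarrow>
     (\<forall>v :: nat \<Rightarrow> complex ^ 'x. (\<Sum>i<k. \<Sum>j<k. sesq (v i) (R i j *v v j)) \<in> \<real>\<^sub>\<ge>\<^sub>0)"

definition completely_positive :: "('x::finite operator \<Rightarrow> 'y::finite operator) \<Rightarrow> bool" where
  "completely_positive F \<longleftrightarrow> (\<forall>k R. block_psd k R \<longrightarrow> block_psd k (\<lambda>i j. F (R i j)))"

definition channels :: "('x::finite operator \<Rightarrow> 'y::finite operator) set" where
  "channels = {F. Vector_Spaces.linear op_scale op_scale F \<and> completely_positive F \<and>
                  (\<forall>\<rho>. trace (F \<rho>) = trace \<rho>)}"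

text \<open>\<open>id_tensor F\<close> is the tensor product of the identity channel on \<open>'e\<close> with the linear map \<open>F\<close>.\<close>

definition id_tensor ::
  "('x::finite operator \<Rightarrow> 'y::finite operator) \<Rightarrow> ('e::finite \<times> 'x) operator \<Rightarrow> ('e \<times> 'y) operator"
where
  "id_tensor F \<rho> = (\<chi> p q. F (\<chi> x x'. \<rho> $ (fst p, x) $ (fst q, x')) $ snd p $ snd q)"

definition diamond_norm :: "('x::finite operator \<Rightarrow> 'y::finite operator) \<Rightarrow> real" where
  "diamond_norm L = (SUP \<rho> \<in> (states :: ('x \<times> 'x) operator set). trace_norm (id_tensor L \<rho>))"

text \<open>
  Signalling from the first input \<open>'a\<close> to the second output \<open>'d\<close>.  The map that discards \<open>'a\<close> and
  applies \<open>C\<close> to \<open>'b\<close> sends \<open>\<rho>\<close> to \<open>C (ptrace_fst \<rho>)\<close>.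
\<close>

definition signalling ::
  "(('a::finite \<times> 'b::finite) operator \<Rightarrow> ('c::finite \<times> 'd::finite) operator) \<Rightarrow> real"
where
  "signalling U = (INF C \<in> (channels :: ('b operator \<Rightarrow> 'd operator) set).
                     diamond_norm (\<lambda>\<rho>. ptrace_fst (U \<rho>) - C (ptrace_fst \<rho>)))"


section \<open>Tensor powers\<close>

text \<open>
  The tensor power over a finite index type \<open>'n\<close>, i.e. the \<open>n\<close>-th one for \<open>n = CARD('n)\<close>, of the
  system \<open>'x\<close> is the system \<open>'n \<Rightarrow> 'x\<close>.
\<close>

definition op_tensor :: "('n::finite \<Rightarrow> 'x::finite operator) \<Rightarrow> ('n \<Rightarrow> 'x) operator" where
  "op_tensor A = (\<chi> x x'. \<Prod>i\<in>UNIV. A i $ x i $ x' i)"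

definition matrix_unit :: "'x::finite \<Rightarrow> 'x \<Rightarrow> 'x operator" where
  "matrix_unit x x' = ketbra (axis x 1) (axis x' 1)"

text \<open>
  The tensor power of a linear map \<open>F\<close> is the linear extension of its action
  \<open>op_tensor E \<mapsto> op_tensor (F \<circ> E)\<close> on products \<open>E\<close> of matrix units; the lemma
  \<open>map_power_op_tensor\<close> shows that it acts in this way on all product operators.
\<close>

definition map_power ::
  "('x::finite operator \<Rightarrow> 'y::finite operator) \<Rightarrow> ('n::finite \<Rightarrow> 'x) operator \<Rightarrow> ('n \<Rightarrow> 'y) operator"
where
  "map_power F \<rho> = (\<Sum>x\<in>UNIV. \<Sum>x'\<in>UNIV.
      op_scale (\<rho> $ x $ x') (op_tensor (\<lambda>i. F (matrix_unit (x i) (x' i)))))"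

lemma op_eq_sum_matrix_unit:
  "A = (\<Sum>x\<in>UNIV. \<Sum>x'\<in>UNIV. op_scale (A $ x $ x') (matrix_unit x x'))"
  for A :: "'x::finite operator"
proof (simp only: vec_eq_iff, intro allI)
  fix i j
  have "(\<Sum>x\<in>UNIV. \<Sum>x'\<in>UNIV. op_scale (A $ x $ x') (matrix_unit x x')) $ i $ j
      = (\<Sum>x\<in>UNIV. \<Sum>x'\<in>UNIV. if x' = j then (if x = i then A $ x $ x' else 0) else 0)"
    unfolding sum_component
    by (intro sum.cong refl) (auto simp: op_scale_def matrix_unit_def ketbra_def axis_def)
  also have "\<dots> = A $ i $ j"
    by simp
  finally show "A $ i $ j =
      (\<Sum>x\<in>UNIV. \<Sum>x'\<in>UNIV. op_scale (A $ x $ x') (matrix_unit x x')) $ i $ j" ..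
qed

lemma map_power_op_tensor:
  fixes F :: "'x::finite operator \<Rightarrow> 'y::finite operator" and A :: "'n::finite \<Rightarrow> 'x operator"
  assumes "Vector_Spaces.linear op_scale op_scale F"
  shows "map_power F (op_tensor A) = op_tensor (\<lambda>i. F (A i))"
proof -
  interpret F: Vector_Spaces.linear op_scale op_scale F by fact
  have ex: "F B $ y $ y' = (\<Sum>p\<in>UNIV. B $ fst p $ snd p * F (matrix_unit (fst p) (snd p)) $ y $ y')"
    for B y y'
  proof -
    have "F B = (\<Sum>x\<in>UNIV. \<Sum>x'\<in>UNIV. op_scale (B $ x $ x') (F (matrix_unit x x')))"
      by (subst op_eq_sum_matrix_unit[of B]) (simp add: F.sum F.scale)
    then show ?thesis
      by (simp add: op_scale_def sum.cartesian_product case_prod_beta)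
  qed
  show ?thesis
  proof (simp only: vec_eq_iff, intro allI)
    fix y y' :: "'n \<Rightarrow> 'y"
    let ?g = "\<lambda>i p. A i $ fst p $ snd p * F (matrix_unit (fst p) (snd p)) $ y i $ y' i"
    have "op_tensor (\<lambda>i. F (A i)) $ y $ y' = (\<Prod>i\<in>UNIV. \<Sum>p\<in>UNIV. ?g i p)"
      by (simp add: op_tensor_def ex[symmetric])
    also have "\<dots> = (\<Sum>h\<in>UNIV. \<Prod>i\<in>UNIV. ?g i (h i))"
      using prod_sum_PiE[of "UNIV :: 'n set" "\<lambda>_. UNIV" ?g] by (simp add: PiE_UNIV_domain)
    also have "\<dots> = (\<Sum>(x, x')\<in>UNIV. \<Prod>i\<in>UNIV. ?g i (x i, x' i))"
      by (rule sum.reindex_bij_witness[where i = "\<lambda>(x, x') i. (x i, x' i)"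
            and j = "\<lambda>h. (fst \<circ> h, snd \<circ> h)"]) (auto simp: fun_eq_iff)
    also have "\<dots> = map_power F (op_tensor A) $ y $ y'"
      by (simp add: map_power_def op_scale_def op_tensor_def prod.distrib sum.cartesian_product
          case_prod_beta)
    finally show "map_power F (op_tensor A) $ y $ y' = op_tensor (\<lambda>i. F (A i)) $ y $ y'" ..
  qed
qed

text \<open>
  The tensor power of a bipartite map, regrouped as a bipartite map on all first systems together
  and all second systems together.
\<close>

definition merge_systems ::
  "(('n::finite \<Rightarrow> 'a::finite) \<times> ('n \<Rightarrow> 'b::finite)) operator \<Rightarrow> ('n \<Rightarrow> 'a \<times> 'b) operator"
where
  "merge_systems \<rho> = (\<chi> f g. \<rho> $ (fst \<circ> f, snd \<circ> f) $ (fst \<circ> g, snd \<circ> g))"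

definition split_systems ::
  "('n::finite \<Rightarrow> 'a::finite \<times> 'b::finite) operator \<Rightarrow> (('n \<Rightarrow> 'a) \<times> ('n \<Rightarrow> 'b)) operator"
where
  "split_systems \<rho> =
     (\<chi> p q. \<rho> $ (\<lambda>i. (fst p i, snd p i)) $ (\<lambda>i. (fst q i, snd q i)))"

definition bipartite_power ::
  "(('a::finite \<times> 'b::finite) operator \<Rightarrow> ('c::finite \<times> 'd::finite) operator) \<Rightarrow>
   (('n::finite \<Rightarrow> 'a) \<times> ('n \<Rightarrow> 'b)) operator \<Rightarrow> (('n \<Rightarrow> 'c) \<times> ('n \<Rightarrow> 'd)) operator"
where
  "bipartite_power F = split_systems \<circ> map_power F \<circ> merge_systems"


section \<open>The CNOT and measurement channels\<close>

text \<open>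
  The computational basis of a qubit is indexed by the type \<open>2\<close> of integers modulo 2, whose
  addition is the exclusive or.  The target is the first qubit and the control is the second one.
\<close>

definition cnot :: "(2 \<times> 2) operator" where
  "cnot = (\<chi> p q. if p = (fst q + snd q, snd q) then 1 else 0)"

definition cnot_channel :: "(2 \<times> 2) operator \<Rightarrow> (2 \<times> 2) operator" where
  "cnot_channel \<rho> = cnot ** \<rho> ** cnot"

definition basis_proj :: "2 \<Rightarrow> 2 operator" where
  "basis_proj i = ketbra (axis i 1) (axis i 1)"

definition measurement_channel :: "2 operator \<Rightarrow> 2 operator" where
  "measurement_channel \<rho> =
     basis_proj 0 ** \<rho> ** basis_proj 0 + basis_proj 1 ** \<rho> ** basis_proj 1"

end

theory Submission
  imports Defs
begin

text \<open>
  Alice's input only affects the off-diagonal part of Bob's output, so tracing out \<open>A\<close> and measuring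
  \<open>B\<close> is the same as measuring \<open>B'\<close> after the CNOT gates.  With the measurement as the comparison
  channel, the signalling is thus bounded by the deviation of a state from its dephasing.  Dephasing
  is the uniform mixture of the conjugations by the \<open>d = 2 ^ n\<close> diagonal sign matrices, one of which
  is the identity, so this deviation is at most \<open>2 (d - 1) / d\<close>; a maximally entangled state attains
  the bound, since it has overlap \<open>1 / d\<close> with its dephasing.  Conversely, by phase kickback Alice
  can steer a maximally entangled state of Bob and a reference into \<open>d\<close> orthogonal states, and the
  output of a comparison channel, which does not depend on her choice, has overlap at most \<open>1 / d\<close>
  with one of them.
\<close>


section \<open>Spectral theorem and trace norm\<close>


text \<open>A maximiser \<open>u\<close> of the Rayleigh quotient on the unit sphere of
  \<open>S\<close> is an eigenvector, because perturbing \<open>u\<close> along the residual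
  \<open>f u - l u\<close> would otherwise increase the quotient. The real setting also covers
  \<open>complex ^ 'x\<close>, whose real inner product is the real part of
  \<open>sesq\<close>.\<close>

lemma self_adjoint_eigenvector:
  fixes f :: "'a::euclidean_space \<Rightarrow> 'a"
  assumes f: "linear f" and adj: "\<And>x y. f x \<bullet> y = x \<bullet> f y"
    and S: "subspace S" and inv: "\<And>x. x \<in> S \<Longrightarrow> f x \<in> S" and z: "z \<in> S" "z \<noteq> 0"
  obtains u l where "u \<in> S" "norm u = 1" "f u = l *\<^sub>R u"
proof -
  let ?K = "S \<inter> sphere 0 1"
  have cpt: "compact ?K"
    by (intro closed_Int_compact closed_subspace S) simp
  have "z /\<^sub>R norm z \<in> ?K"
    using S z by (simp add: subspace_scale)
  then have ne: "?K \<noteq> {}" by blast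
  have cont: "continuous_on ?K (\<lambda>x. x \<bullet> f x)"
    using f by (intro continuous_intros linear_continuous_on linear_conv_bounded_linear[THEN iffD1])
  obtain u where u: "u \<in> ?K" and mx: "\<And>x. x \<in> ?K \<Longrightarrow> x \<bullet> f x \<le> u \<bullet> f u"
    using continuous_attains_sup[OF cpt ne cont] by blast
  define l where "l = u \<bullet> f u"
  have uu: "u \<bullet> u = 1" using u by (simp add: norm_eq_1)
  have bound: "x \<bullet> f x \<le> l * (x \<bullet> x)" if "x \<in> S" for x
  proof (cases "x = 0")
    case True
    then show ?thesis using linear_0[OF f] by simp
  next
    case False
    then have "x /\<^sub>R norm x \<in> ?K" using S that by (simp add: subspace_scale)
    from mx[OF this] have "x \<bullet> f x / (norm x)\<^sup>2 \<le> l"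
      by (simp add: linear_scale[OF f] l_def power2_eq_square divide_inverse ac_simps)
    then show ?thesis using False by (simp add: divide_le_eq power2_norm_eq_inner)
  qed
  define w where "w = f u - l *\<^sub>R u"
  have wS: "w \<in> S" using u S inv by (simp add: w_def subspace_diff subspace_scale)
  define c where "c = l * (w \<bullet> w) - w \<bullet> f w"
  \<comment> \<open>First-order condition: in the bound at \<open>u + t w\<close> the terms
    \<open>2 t l (u \<bullet> w)\<close> cancel, and what is linear in \<open>t\<close> has to be
    dominated by a quadratic term.\<close>
  have key: "2 * t * (w \<bullet> w) \<le> t\<^sup>2 * c" for t
  proof -
    have "u + t *\<^sub>R w \<in> S" using u S wS by (simp add: subspace_add subspace_scale)
    from bound[OF this]
    have "l + t * (u \<bullet> f w) + t * (w \<bullet> f u) + t\<^sup>2 * (w \<bullet> f w)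
        \<le> l * (1 + 2 * t * (u \<bullet> w) + t\<^sup>2 * (w \<bullet> w))"
      by (simp add: linear_add[OF f] linear_scale[OF f] inner_add_left inner_add_right l_def[symmetric]
          uu inner_commute[of w u] power2_eq_square algebra_simps)
    moreover have "u \<bullet> f w = w \<bullet> f u" by (metis adj inner_commute)
    moreover have "w \<bullet> f u = w \<bullet> w + l * (u \<bullet> w)"
      by (simp add: w_def inner_diff_right inner_diff_left inner_commute[of u "f u"] algebra_simps)
    ultimately show ?thesis by (simp add: c_def algebra_simps)
  qed
  have "w = 0"
  proof (rule ccontr)
    assume "w \<noteq> 0"
    then have pos: "w \<bullet> w > 0" by simp
    \<comment> \<open>Small enough that \<open>t * c\<close> is at most
      \<open>w \<bullet> w\<close>; the summand 1 keeps the denominator positive when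
      \<open>c = 0\<close>.\<close>
    define t where "t = (w \<bullet> w) / (\<bar>c\<bar> + 1)"
    have t: "t > 0" using pos by (simp add: t_def)
    have "t * (2 * (w \<bullet> w)) \<le> t * (t * c)" using key[of t] by (simp add: power2_eq_square ac_simps)
    then have "2 * (w \<bullet> w) \<le> t * c" using t by simp
    also have "\<dots> \<le> t * (\<bar>c\<bar> + 1)" using t by (intro mult_left_mono) auto
    also have "\<dots> = w \<bullet> w" by (simp add: t_def)
    finally show False using pos by simp
  qed
  then show ?thesis using that[of u l] u by (simp add: w_def)
qed

section \<open>The Hermitian form, orthonormal bases and the spectral theorem\<close>

lemma cnj_sesq: "cnj (sesq v w) = sesq w v"
  by (simp add: sesq_def mult.commute)

lemma sesq_simps:
  "sesq v (w + w') = sesq v w + sesq v w'"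
  "sesq v (w - w') = sesq v w - sesq v w'"
  "sesq v (c *s w) = c * sesq v w"
  "sesq v (r *\<^sub>R w) = of_real r * sesq v w"
  "sesq v 0 = 0"
  "sesq v (\<Sum>i\<in>I. g i) = (\<Sum>i\<in>I. sesq v (g i))"
  by (auto simp: sesq_def sum.distrib sum_subtractf sum_distrib_left algebra_simps
      scaleR_conv_of_real[where 'a = complex] intro: sum.swap)

lemma Re_sesq: "Re (sesq v w) = v \<bullet> w"
  by (simp add: sesq_def inner_vec_def inner_complex_def)

lemma sesq_self: "sesq v v = of_real ((norm v)\<^sup>2)"
proof -
  have "Im (sesq v v) = 0"
    by (simp add: sesq_def mult.commute)
  then show ?thesis
    by (simp add: complex_eq_iff Re_sesq power2_norm_eq_inner)
qed

lemma sesq_adjoint: "sesq (A *v v) w = sesq v (dagger A *v w)"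
proof -
  have "sesq (A *v v) w = (\<Sum>i\<in>UNIV. \<Sum>j\<in>UNIV. cnj (A $ i $ j) * cnj (v $ j) * w $ i)"
    by (simp add: sesq_def matrix_vector_mult_def sum_distrib_right)
  also have "\<dots> = (\<Sum>j\<in>UNIV. \<Sum>i\<in>UNIV. cnj (A $ i $ j) * cnj (v $ j) * w $ i)"
    by (rule sum.swap)
  also have "\<dots> = sesq v (dagger A *v w)"
    by (simp add: sesq_def matrix_vector_mult_def dagger_def sum_distrib_left ac_simps)
  finally show ?thesis .
qed

lemma sesq_matrix_vector: "sesq v (A *v w) = (\<Sum>i\<in>UNIV. \<Sum>j\<in>UNIV. cnj (v $ i) * A $ i $ j * w $ j)"
  by (simp add: sesq_def matrix_vector_mult_def sum_distrib_left ac_simps)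

text \<open>Completeness is recorded as the expansion of every vector, the form in which traces and
  norms use it.\<close>

definition orthonormal_basis :: "(complex ^ 'x::finite) set \<Rightarrow> bool" where
  "orthonormal_basis B \<longleftrightarrow> finite B \<and> (\<forall>v\<in>B. \<forall>w\<in>B. sesq v w = (if v = w then 1 else 0)) \<and>
     (\<forall>w. w = (\<Sum>v\<in>B. sesq v w *s v))"

text \<open>An orthonormal set of eigenvectors of maximal size is complete: its orthogonal
  complement is invariant under \<open>A\<close>, so a nonzero vector there would yield one more
  eigenvector.\<close>

theorem hermitian_eigenbasis:
  fixes A :: "'x::finite operator"
  assumes A: "dagger A = A"
  obtains B l where "orthonormal_basis B" "\<And>v. v \<in> B \<Longrightarrow> A *v v = l v *\<^sub>R v"
proof -
  define ok where "ok B \<longleftrightarrow> finite B \<and> (\<forall>v\<in>B. \<forall>w\<in>B. sesq v w = (if v = w then 1 else 0)) \<and>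
    (\<forall>v\<in>B. \<exists>l. A *v v = l *\<^sub>R v)" for B :: "(complex ^ 'x) set"
  \<comment> \<open>The real dimension is a crude bound, but it suffices for a largest
    \<open>B\<close> to exist.\<close>
  have card: "card B \<le> DIM(complex ^ 'x)" if "ok B" for B
  proof -
    have "pairwise orthogonal B"
      using that by (auto simp: pairwise_def orthogonal_def ok_def Re_sesq[symmetric])
    moreover have "0 \<notin> B"
    proof
      assume "0 \<in> B"
      then have "sesq 0 (0 :: complex ^ 'x) = 1" using that by (simp add: ok_def)
      then show False by (simp add: sesq_def)
    qed
    ultimately have "independent B" by (rule pairwise_orthogonal_independent)
    then show ?thesis by (rule independent_bound[THEN conjunct2])
  qed
  have "ok {}" by (simp add: ok_def)
  then obtain B where B: "ok B" and max: "\<And>B'. ok B' \<Longrightarrow> card B' \<le> card B"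
    using ex_has_greatest_nat[of ok "{}" card "DIM(complex ^ 'x) + 1"] card
    by (metis Suc_eq_plus1 le_imp_less_Suc)
  have fin: "finite B" and orth: "\<And>v w. v \<in> B \<Longrightarrow> w \<in> B \<Longrightarrow> sesq v w = (if v = w then 1 else 0)"
    and eig: "\<And>v. v \<in> B \<Longrightarrow> \<exists>l. A *v v = l *\<^sub>R v"
    using B by (auto simp: ok_def)
  define S where "S = {w. \<forall>v\<in>B. sesq v w = 0}"
  have S0: "w = 0" if w: "w \<in> S" for w
  proof (rule ccontr)
    assume "w \<noteq> 0"
    have "subspace S" by (auto simp: S_def subspace_def sesq_simps)
    moreover have "A *v x \<in> S" if x: "x \<in> S" for x
    proof -
      have "sesq v (A *v x) = 0" if v: "v \<in> B" for v
      proof -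
        obtain l where l: "A *v v = l *\<^sub>R v" using eig[OF v] by blast
        have "sesq v (A *v x) = sesq (A *v v) x" by (simp add: sesq_adjoint A)
        also have "\<dots> = cnj (sesq x (l *\<^sub>R v))" by (simp add: cnj_sesq l)
        also have "\<dots> = of_real l * sesq v x" by (simp add: sesq_simps cnj_sesq)
        finally show ?thesis using x v by (simp add: S_def)
      qed
      then show ?thesis by (simp add: S_def)
    qed
    moreover have "(A *v x) \<bullet> y = x \<bullet> (A *v y)" for x y
      by (simp only: Re_sesq[symmetric] sesq_adjoint A)
    moreover have "linear ((*v) A)"
      by (rule linearI) (simp_all add: vec_eq_iff matrix_vector_mult_def
        scaleR_sum_right sum.distrib distrib_left)
    ultimately obtain u l where u: "u \<in> S" "norm u = 1" "A *v u = l *\<^sub>R u"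
      using self_adjoint_eigenvector[of "(*v) A" S w] w \<open>w \<noteq> 0\<close> by blast
    have uu: "sesq u u = 1" using u by (simp add: sesq_self)
    have uB: "sesq v u = 0" "sesq u v = 0" if "v \<in> B" for v
      using u(1) that cnj_sesq[of v u] by (auto simp: S_def)
    have "u \<notin> B" using uB uu by fastforce
    have "ok (insert u B)"
      using B u uu uB \<open>u \<notin> B\<close> by (auto simp: ok_def)
    from max[OF this] show False using \<open>u \<notin> B\<close> fin by simp
  qed
  have compl: "w = (\<Sum>v\<in>B. sesq v w *s v)" for w
  proof -
    have "w - (\<Sum>v\<in>B. sesq v w *s v) \<in> S"
    proof -
      have "sesq v (w - (\<Sum>v\<in>B. sesq v w *s v)) = 0" if "v \<in> B" for v
      proof -
        have "(\<Sum>u\<in>B. sesq u w * sesq v u) = (\<Sum>u\<in>B. if u = v then sesq v w else 0)"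
          using that by (intro sum.cong) (auto simp: orth)
        then show ?thesis using that fin by (simp add: sesq_simps)
      qed
      then show ?thesis by (simp add: S_def)
    qed
    from S0[OF this] show ?thesis by simp
  qed
  obtain l where "\<And>v. v \<in> B \<Longrightarrow> A *v v = l v *\<^sub>R v" using eig by metis
  then show ?thesis using that[of B l] fin orth compl by (auto simp: orthonormal_basis_def)
qed


lemma matrix_vector_mult_sum_scaled:
  fixes A :: "'x::finite operator"
  shows "A *v (\<Sum>v\<in>B. c v *s g v) = (\<Sum>v\<in>B. c v *s (A *v g v))"
  by (auto simp: vec_eq_iff matrix_vector_mult_def sum_distrib_left ac_simps intro: sum.swap)

lemma matrix_vector_mult_scaleR:
  fixes A :: "'x::finite operator"
  shows "A *v (r *\<^sub>R v) = r *\<^sub>R (A *v v)"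
  by (simp add: vec_eq_iff matrix_vector_mult_def scaleR_sum_right)

lemma sesq_scaleR_left: "sesq (r *\<^sub>R v) w = of_real r * sesq v w"
  by (simp add: sesq_def scaleR_conv_of_real[where 'a = complex] sum_distrib_left ac_simps)

lemma orthonormal_basis_finite: "orthonormal_basis B \<Longrightarrow> finite B"
  by (simp add: orthonormal_basis_def)

lemma orthonormal_basis_sesq: "orthonormal_basis B \<Longrightarrow> v \<in> B \<Longrightarrow> sesq v v = 1"
  by (simp add: orthonormal_basis_def)

lemma orthonormal_basis_ext:
  fixes M N :: "'x::finite operator"
  assumes B: "orthonormal_basis B" and eq: "\<And>v. v \<in> B \<Longrightarrow> M *v v = N *v v"
  shows "M = N"
  unfolding matrix_eq
proof
  fix w
  have w: "w = (\<Sum>v\<in>B. sesq v w *s v)" using B by (simp add: orthonormal_basis_def)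
  have "M *v (\<Sum>v\<in>B. sesq v w *s v) = N *v (\<Sum>v\<in>B. sesq v w *s v)"
    by (simp add: matrix_vector_mult_sum_scaled eq)
  then show "M *v w = N *v w" by (simp only: w[symmetric])
qed

lemma trace_orthonormal_basis:
  fixes A :: "'x::finite operator"
  assumes B: "orthonormal_basis B"
  shows "trace A = (\<Sum>v\<in>B. sesq v (A *v v))"
proof -
  \<comment> \<open>Entries of the resolution of the identity, read off from the expansion of the
    standard basis vectors.\<close>
  have id: "(\<Sum>v\<in>B. v $ j * cnj (v $ i)) = (if j = i then 1 else 0)" for i j
  proof -
    have "sesq v (axis i 1) = cnj (v $ i)" for v :: "complex ^ 'x"
      by (simp add: sesq_def axis_def if_distrib cong: if_cong)
    moreover have "axis i 1 $ j = (\<Sum>v\<in>B. sesq v (axis i 1) *s v) $ j"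
      using B by (simp add: orthonormal_basis_def)
    ultimately show ?thesis by (auto simp: axis_def mult.commute)
  qed
  have "(\<Sum>v\<in>B. sesq v (A *v v))
      = (\<Sum>i\<in>UNIV. \<Sum>v\<in>B. \<Sum>j\<in>UNIV. A $ i $ j * (v $ j * cnj (v $ i)))"
    unfolding sesq_matrix_vector by (subst sum.swap) (simp add: ac_simps)
  also have "\<dots> = (\<Sum>i\<in>UNIV. \<Sum>j\<in>UNIV. A $ i $ j * (\<Sum>v\<in>B. v $ j * cnj (v $ i)))"
    by (subst sum.swap) (simp add: sum_distrib_left)
  also have "\<dots> = trace A"
    by (simp add: id trace_def if_distrib cong: if_cong)
  finally show ?thesis ..
qed

lemma parseval:
  assumes B: "orthonormal_basis B"
  shows "(\<Sum>v\<in>B. (cmod (sesq v w))\<^sup>2) = (norm w)\<^sup>2"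
proof -
  have "sesq w w = sesq w (\<Sum>v\<in>B. sesq v w *s v)"
    using B by (simp add: orthonormal_basis_def)
  also have "\<dots> = (\<Sum>v\<in>B. sesq v w * sesq w v)"
    by (simp only: sesq_simps)
  also have "\<dots> = of_real (\<Sum>v\<in>B. (cmod (sesq v w))\<^sup>2)"
    unfolding of_real_sum complex_norm_square cnj_sesq ..
  finally show ?thesis unfolding sesq_self by (simp only: of_real_eq_iff)
qed

section \<open>Positive semidefinite operators and their square roots\<close>

lemma psd_iff: "psd A \<longleftrightarrow> (\<forall>v. Re (sesq v (A *v v)) \<ge> 0 \<and> Im (sesq v (A *v v)) = 0)"
  by (simp add: psd_def complex_nonneg_Reals_iff)

lemma sesq_axis: "sesq (axis i c) w = cnj c * w $ i"
proof -
  have "sesq (axis i c) w = (\<Sum>j\<in>UNIV. if i = j then cnj c * w $ i else 0)"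
    unfolding sesq_def by (intro sum.cong) (auto simp: axis_def)
  then show ?thesis by simp
qed

lemma matrix_vector_mult_axis:
  fixes A :: "'x::finite operator"
  shows "(A *v axis j c) $ i = A $ i $ j * c"
proof -
  have "(A *v axis j c) $ i = (\<Sum>k\<in>UNIV. if j = k then A $ i $ j * c else 0)"
    unfolding matrix_vector_mult_def vec_lambda_beta by (intro sum.cong) (auto simp: axis_def)
  then show ?thesis by simp
qed

lemma sesq_add_left: "sesq (v + v') w = sesq v w + sesq v' w"
  by (simp add: sesq_def sum.distrib algebra_simps)

lemma psd_hermitian:
  assumes "psd A"
  shows "dagger A = A"
proof -
  have "cnj (A $ j $ i) = A $ i $ j" for i j
  proof -
    have e: "Im (cnj c * A $ i $ i * c + cnj c * A $ i $ j * d + cnj d * A $ j $ i * c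
        + cnj d * A $ j $ j * d) = 0" for c d
    proof -
      have "Im (sesq (axis i c + axis j d) (A *v (axis i c + axis j d))) = 0"
        using assms by (simp add: psd_iff)
      then show ?thesis
        by (simp add: matrix_vector_right_distrib sesq_add_left sesq_simps sesq_axis
            matrix_vector_mult_axis algebra_simps)
    qed
    \<comment> \<open>Polarisation: the first two choices make the diagonal entries real,
      \<open>(1, 1)\<close> makes the imaginary parts of the two off-diagonal entries opposite, and
      \<open>(1, \<i>)\<close> equates their real parts.\<close>
    from e[of 1 0] e[of 0 1] e[of 1 1] e[of 1 \<i>] show ?thesis
      by (simp add: complex_eq_iff)
  qed
  then show ?thesis by (simp add: dagger_def vec_eq_iff)
qed

lemma psd_diagonal:
  assumes "psd A"
  shows "Re (A $ i $ i) \<ge> 0"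
proof -
  have "sesq (axis i 1) (A *v axis i 1) = A $ i $ i"
    by (simp add: sesq_axis matrix_vector_mult_axis)
  then show ?thesis using assms unfolding psd_iff by metis
qed

lemma dagger_diff: "dagger (A - B) = dagger A - dagger B"
  by (simp add: dagger_def vec_eq_iff)

text \<open>Let \<open>v\<close> be an eigenvector of \<open>D = S - T\<close> with eigenvalue
  \<open>l\<close>, and let \<open>s, t \<ge> 0\<close> be the expectations of \<open>S\<close> and
  \<open>T\<close> in \<open>v\<close>. Then \<open>S D + D T = 0\<close> gives
  \<open>l (s + t) = 0\<close>, while \<open>l = s - t\<close>; hence \<open>l = 0\<close>. This
  makes the description in \<open>psd_sqrt\<close> well determined.\<close>

lemma psd_square_root_unique:
  assumes S: "psd S" and T: "psd T" and eq: "S ** S = T ** T"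
  shows "S = T"
proof -
  define D where "D = S - T"
  have DH: "dagger D = D" using S T by (simp add: D_def dagger_diff psd_hermitian)
  obtain B l where B: "orthonormal_basis B" and l: "\<And>v. v \<in> B \<Longrightarrow> D *v v = l v *\<^sub>R v"
    using hermitian_eigenbasis[OF DH] by blast
  have "l v = 0" if v: "v \<in> B" for v
  proof -
    define s t where "s = Re (sesq v (S *v v))" and "t = Re (sesq v (T *v v))"
    have st: "s \<ge> 0" "t \<ge> 0" using S T by (simp_all add: s_def t_def psd_iff)
    have "S *v (S *v v) = T *v (T *v v)"
      by (simp only: matrix_vector_mul_assoc eq)
    then have "S *v (D *v v) + D *v (T *v v) = 0"
      by (simp add: D_def matrix_vector_mult_diff_rdistrib matrix_vector_mult_diff_distrib)
    moreover have "sesq v (D *v (T *v v)) = of_real (l v) * sesq v (T *v v)"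
      using sesq_adjoint[of D v "T *v v"] by (simp add: DH l v sesq_scaleR_left)
    moreover have "sesq v (S *v (D *v v)) = of_real (l v) * sesq v (S *v v)"
      by (simp add: l v sesq_simps matrix_vector_mult_scaleR)
    ultimately have "of_real (l v) * sesq v (S *v v) + of_real (l v) * sesq v (T *v v) = 0"
      by (metis sesq_simps(1,5))
    from arg_cong[OF this, of Re] have 1: "l v * (s + t) = 0"
      by (simp add: s_def t_def algebra_simps)
    have "sesq v (D *v v) = sesq v (S *v v) - sesq v (T *v v)"
      by (simp add: D_def matrix_vector_mult_diff_rdistrib sesq_simps)
    moreover have "sesq v (D *v v) = of_real (l v)"
      by (simp add: l v sesq_simps orthonormal_basis_sesq[OF B v])
    ultimately have "l v = s - t" by (metis Re_complex_of_real minus_complex.simps(1) s_def t_def)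
    with 1 st show ?thesis by auto
  qed
  then have "D = 0" by (intro orthonormal_basis_ext[OF B]) (simp add: l)
  then show ?thesis by (simp add: D_def)
qed

section \<open>Trace norms of Hermitian operators\<close>

text \<open>Replacing each eigenvalue by its absolute value gives a positive square root of
  \<open>dagger X ** X\<close>, hence the one that \<open>psd_sqrt\<close> denotes.\<close>

lemma trace_norm_hermitian:
  assumes X: "dagger X = X" and B: "orthonormal_basis B"
    and l: "\<And>v. v \<in> B \<Longrightarrow> X *v v = l v *\<^sub>R v"
  shows "trace_norm X = (\<Sum>v\<in>B. \<bar>l v\<bar>)"
proof -
  define S where "S = (\<Sum>v\<in>B. op_scale (of_real \<bar>l v\<bar>) (ketbra v v))"
  have S: "S *v w = (\<Sum>v\<in>B. (of_real \<bar>l v\<bar> * sesq v w) *s v)" for w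
  proof -
    have "S *v w = (\<Sum>v\<in>B. op_scale (of_real \<bar>l v\<bar>) (ketbra v v) *v w)"
      unfolding S_def
      by (auto simp: vec_eq_iff matrix_vector_mult_def sum_distrib_right intro: sum.swap)
    then show ?thesis
      by (simp add: vec_eq_iff matrix_vector_mult_def op_scale_def ketbra_def sesq_def
          sum_distrib_left sum_distrib_right ac_simps)
  qed
  have Sv: "S *v v = \<bar>l v\<bar> *\<^sub>R v" if v: "v \<in> B" for v
  proof -
    have "S *v v = (\<Sum>u\<in>B. if u = v then of_real \<bar>l v\<bar> *s v else 0)"
      unfolding S using B v by (intro sum.cong) (auto simp: orthonormal_basis_def)
    then have "S *v v = of_real \<bar>l v\<bar> *s v"
      using orthonormal_basis_finite[OF B] v by simp
    then show ?thesis
      by (simp add: vec_eq_iff scaleR_conv_of_real[where 'a = complex])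
  qed
  have psdS: "psd S"
  proof -
    have "sesq w (S *v w) = of_real (\<Sum>v\<in>B. \<bar>l v\<bar> * (cmod (sesq v w))\<^sup>2)" for w
    proof -
      have "sesq w (S *v w) = (\<Sum>v\<in>B. of_real \<bar>l v\<bar> * (sesq v w * sesq w v))"
        unfolding S sesq_simps by (simp only: ac_simps)
      then show ?thesis
        unfolding of_real_sum of_real_mult complex_norm_square cnj_sesq .
    qed
    then show ?thesis by (simp add: psd_iff sum_nonneg)
  qed
  have "S ** S = dagger X ** X"
    unfolding X
    by (rule orthonormal_basis_ext[OF B])
      (simp add: matrix_vector_mul_assoc[symmetric] Sv l matrix_vector_mult_scaleR)
  then have "psd_sqrt (dagger X ** X) = S"
    unfolding psd_sqrt_def
    by (intro the_equality) (use psdS in \<open>auto intro: psd_square_root_unique\<close>)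
  then have "trace_norm X = Re (\<Sum>v\<in>B. sesq v (S *v v))"
    by (simp add: trace_norm_def trace_orthonormal_basis[OF B])
  also have "\<dots> = (\<Sum>v\<in>B. \<bar>l v\<bar>)"
    by (simp add: Sv sesq_simps orthonormal_basis_sesq[OF B])
  finally show ?thesis .
qed

text \<open>In an eigenbasis of \<open>P - Q\<close> each eigenvalue is a difference of two
  nonnegative diagonal entries, so its modulus is at most their sum.\<close>

lemma trace_norm_diff_le:
  assumes P: "psd P" and Q: "psd Q"
  shows "trace_norm (P - Q) \<le> Re (trace P) + Re (trace Q)"
proof -
  have X: "dagger (P - Q) = P - Q" using P Q by (simp add: dagger_diff psd_hermitian)
  obtain B l where B: "orthonormal_basis B" and l: "\<And>v. v \<in> B \<Longrightarrow> (P - Q) *v v = l v *\<^sub>R v"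
    using hermitian_eigenbasis[OF X] by blast
  have "\<bar>l v\<bar> \<le> Re (sesq v (P *v v)) + Re (sesq v (Q *v v))" if v: "v \<in> B" for v
  proof -
    have "sesq v ((P - Q) *v v) = of_real (l v)"
      by (simp add: l v sesq_simps orthonormal_basis_sesq[OF B v])
    then have "l v = Re (sesq v (P *v v)) - Re (sesq v (Q *v v))"
      unfolding matrix_vector_mult_diff_rdistrib sesq_simps by (metis Re_complex_of_real minus_complex.simps(1))
    moreover have "Re (sesq v (P *v v)) \<ge> 0" "Re (sesq v (Q *v v)) \<ge> 0"
      using P Q by (simp_all add: psd_iff)
    ultimately show ?thesis by linarith
  qed
  then have "(\<Sum>v\<in>B. \<bar>l v\<bar>) \<le> (\<Sum>v\<in>B. Re (sesq v (P *v v)) + Re (sesq v (Q *v v)))"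
    by (rule sum_mono)
  then show ?thesis
    by (simp add: trace_norm_hermitian[OF X B l] trace_orthonormal_basis[OF B] sum.distrib)
qed

text \<open>Testing with the Hermitian unitary \<open>2 |\<psi>\<rangle>\<langle>\<psi>| - 1\<close>.\<close>

lemma trace_norm_ge:
  assumes X: "dagger X = X" and psi: "sesq \<psi> \<psi> = 1"
  shows "2 * Re (sesq \<psi> (X *v \<psi>)) - Re (trace X) \<le> trace_norm X"
proof -
  obtain B l where B: "orthonormal_basis B" and l: "\<And>v. v \<in> B \<Longrightarrow> X *v v = l v *\<^sub>R v"
    using hermitian_eigenbasis[OF X] by blast
  define p where "p v = (cmod (sesq v \<psi>))\<^sup>2" for v
  have sp: "(\<Sum>v\<in>B. p v) = 1"
    using psi unfolding p_def parseval[OF B] sesq_self of_real_eq_1_iff .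
  have p1: "0 \<le> p v" "p v \<le> 1" if "v \<in> B" for v
    using member_le_sum[of v B p] that B sp by (auto simp: p_def orthonormal_basis_def)
  have "sesq \<psi> (X *v \<psi>) = sesq \<psi> (X *v (\<Sum>v\<in>B. sesq v \<psi> *s v))"
    using B by (simp add: orthonormal_basis_def)
  also have "\<dots> = (\<Sum>v\<in>B. of_real (l v) * (sesq v \<psi> * sesq \<psi> v))"
    unfolding matrix_vector_mult_sum_scaled by (simp add: l sesq_simps ac_simps)
  also have "\<dots> = of_real (\<Sum>v\<in>B. l v * p v)"
    unfolding of_real_sum of_real_mult p_def complex_norm_square cnj_sesq ..
  finally have 1: "Re (sesq \<psi> (X *v \<psi>)) = (\<Sum>v\<in>B. l v * p v)" by simp
  have 2: "Re (trace X) = (\<Sum>v\<in>B. l v)"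
    by (simp add: trace_orthonormal_basis[OF B] l sesq_simps orthonormal_basis_sesq[OF B])
  \<comment> \<open>The factor \<open>2 * p v - 1\<close> is the expectation of the test unitary in
    the eigenvector \<open>v\<close>, and lies in \<open>[-1, 1]\<close>.\<close>
  have "(\<Sum>v\<in>B. l v * (2 * p v - 1)) \<le> (\<Sum>v\<in>B. \<bar>l v\<bar>)"
  proof (rule sum_mono)
    fix v assume v: "v \<in> B"
    have "l v * (2 * p v - 1) \<le> \<bar>l v\<bar> * \<bar>2 * p v - 1\<bar>"
      by (metis abs_ge_self abs_mult)
    also have "\<dots> \<le> \<bar>l v\<bar> * 1"
      using p1[OF v] by (intro mult_left_mono) auto
    finally show "l v * (2 * p v - 1) \<le> \<bar>l v\<bar>" by simp
  qed
  then show ?thesis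
    by (simp add: 1 2 trace_norm_hermitian[OF X B l] algebra_simps sum_subtractf sum.distrib
        sum_distrib_left)
qed


section \<open>Ways to build positive operators and states\<close>

lemma psd_scale:
  assumes "psd A" "r \<ge> 0"
  shows "psd (op_scale (of_real r) A)"
proof -
  have "sesq v (op_scale (of_real r) A *v v) = of_real r * sesq v (A *v v)" for v
    by (simp add: sesq_matrix_vector op_scale_def sum_distrib_left ac_simps)
  then show ?thesis using assms by (simp add: psd_iff)
qed

lemma psd_sum:
  assumes "\<And>i. i \<in> I \<Longrightarrow> psd (A i)"
  shows "psd (\<Sum>i\<in>I. A i)"
proof -
  have "(\<Sum>i\<in>I. A i) *v v = (\<Sum>i\<in>I. A i *v v)" for v
    by (auto simp: vec_eq_iff matrix_vector_mult_def sum_distrib_right intro: sum.swap)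
  then show ?thesis using assms by (simp add: psd_iff sesq_simps sum_nonneg)
qed

text \<open>The operator has the form \<open>K A K^*\<close>, where row \<open>p\<close> of
  \<open>K\<close> has the single nonzero candidate \<open>c p\<close> in column \<open>f p\<close>.
  With \<open>f\<close> the identity this is conjugation by a diagonal matrix; with
  \<open>c = 1\<close> it is a reindexing, as in the terms of a partial trace.\<close>

lemma psd_congruence:
  fixes A :: "'x::finite operator" and f :: "'y::finite \<Rightarrow> 'x"
  assumes A: "psd A"
  shows "psd (\<chi> p q. c p * A $ f p $ f q * cnj (c q))"
proof -
  have "\<exists>w. sesq v ((\<chi> p q. c p * A $ f p $ f q * cnj (c q)) *v v) = sesq w (A *v w)" for v
  proof
    \<comment> \<open>The witness is \<open>K^* v\<close>, written in the standard basis.\<close>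
    let ?g = "\<lambda>q. axis (f q) 1 :: complex ^ 'x" and ?a = "\<lambda>q. cnj (c q) * v $ q"
    have "sesq (\<Sum>q\<in>UNIV. ?a q *s ?g q) w = (\<Sum>q\<in>UNIV. cnj (?a q) * w $ f q)" for w
    proof -
      have "sesq w (\<Sum>q\<in>UNIV. ?a q *s ?g q) = (\<Sum>q\<in>UNIV. ?a q * cnj (w $ f q))"
        unfolding sesq_simps cnj_sesq[of "?g _", symmetric] sesq_axis by simp
      from arg_cong[OF this, of cnj] show ?thesis by (simp add: cnj_sesq)
    qed
    then show "sesq v ((\<chi> p q. c p * A $ f p $ f q * cnj (c q)) *v v) =
        sesq (\<Sum>q\<in>UNIV. ?a q *s ?g q) (A *v (\<Sum>q\<in>UNIV. ?a q *s ?g q))"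
      by (simp add: matrix_vector_mult_sum_scaled sesq_matrix_vector matrix_vector_mult_axis
          sum_distrib_left ac_simps)
  qed
  then show ?thesis using A unfolding psd_iff by metis
qed

lemma sesq_ketbra: "sesq v (ketbra \<psi> \<psi> *v v) = of_real ((cmod (sesq \<psi> v))\<^sup>2)"
proof -
  have "ketbra \<psi> \<psi> *v v = sesq \<psi> v *s \<psi>"
    by (simp add: vec_eq_iff matrix_vector_mult_def ketbra_def sesq_def sum_distrib_left ac_simps)
  then show ?thesis by (simp only: sesq_simps complex_norm_square cnj_sesq)
qed

lemma psd_ketbra: "psd (ketbra \<psi> \<psi>)"
  by (simp add: psd_iff sesq_ketbra)

lemma trace_ketbra: "trace (ketbra \<psi> \<psi>) = sesq \<psi> \<psi>"
  by (simp add: trace_def ketbra_def sesq_def mult.commute)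

lemma ketbra_state: "sesq \<psi> \<psi> = 1 \<Longrightarrow> ketbra \<psi> \<psi> \<in> states"
  by (simp add: states_def psd_ketbra trace_ketbra)

lemma states_nonempty: "(states :: 'x::finite operator set) \<noteq> {}"
proof -
  have "ketbra (axis undefined 1) (axis undefined 1) \<in> (states :: 'x operator set)"
    by (rule ketbra_state) (simp add: sesq_axis)
  then show ?thesis by blast
qed

lemma trace_op_scale: "trace (op_scale c A) = c * trace A"
  by (simp add: trace_def op_scale_def sum_distrib_left)

lemma trace_sum: "trace (\<Sum>i\<in>I. A i) = (\<Sum>i\<in>I. trace (A i))"
  by (auto simp: trace_def intro: sum.swap)

lemma sum_UNIV_Times: "(\<Sum>p\<in>UNIV. f p) = (\<Sum>e\<in>UNIV. \<Sum>x\<in>UNIV. f (e, x))"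
  by (simp add: sum.cartesian_product)


section \<open>Signs and dephasing\<close>

lemma UNIV_qubit: "UNIV = {0, 1 :: 2}"
  using UNIV_2 by auto

lemma qubit_add_self: "(a :: 2) + a = 0"
  using exhaust_2[of a] by auto

lemma qubit_add_add: "(a :: 2) + b + b = a"
  by (simp add: add.assoc qubit_add_self)

text \<open>The sign \<open>(-1)^(a b)\<close>.\<close>

definition qubit_sign :: "2 \<Rightarrow> 2 \<Rightarrow> complex" where
  "qubit_sign a b = (if a = 1 \<and> b = 1 then - 1 else 1)"

text \<open>The Walsh character \<open>(-1)^(z . b)\<close> of the group of bit strings; for fixed
  \<open>z\<close> it is the diagonal of a product of Pauli Z matrices.\<close>

definition character :: "('n::finite \<Rightarrow> 2) \<Rightarrow> ('n \<Rightarrow> 2) \<Rightarrow> complex" where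
  "character z b = (\<Prod>i\<in>UNIV. qubit_sign (z i) (b i))"

lemma character_zero: "character (\<lambda>_. 0) b = 1"
  by (simp add: character_def qubit_sign_def)

lemma cnj_character: "cnj (character z b) = character z b"
  by (simp add: character_def qubit_sign_def if_distrib cong: if_cong)

lemma character_square: "character z b * character z b = 1"
  by (simp add: character_def prod.distrib[symmetric] qubit_sign_def if_distrib cong: if_cong)

lemma qubit_sign_add: "qubit_sign z (a + b) = qubit_sign z a * qubit_sign z b"
proof -
  have "a \<in> {0, 1}" "b \<in> {0, 1}" using UNIV_qubit by blast+
  then show ?thesis by (auto simp: qubit_sign_def qubit_add_self)
qed

lemma character_add: "character z (\<lambda>i. a i + b i) = character z a * character z b"
  by (simp add: character_def qubit_sign_add prod.distrib)

text \<open>The sum over \<open>z\<close> factorises over the qubits, with a factor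
  \<open>1 + 1\<close> where the strings agree and \<open>1 - 1\<close> where they differ.\<close>

lemma character_orthogonality:
  fixes b b' :: "'n::finite \<Rightarrow> 2"
  shows "(\<Sum>z\<in>UNIV. character z b * character z b') = (if b = b' then of_nat CARD('n \<Rightarrow> 2) else 0)"
proof -
  let ?g = "\<lambda>i t. qubit_sign t (b i) * qubit_sign t (b' i)"
  have "(\<Sum>z\<in>UNIV. character z b * character z b') = (\<Prod>i\<in>UNIV. \<Sum>t\<in>UNIV. ?g i t)"
    using prod_sum_PiE[of "UNIV :: 'n set" "\<lambda>_. UNIV" ?g]
    by (simp add: PiE_UNIV_domain character_def prod.distrib)
  also have "\<dots> = (\<Prod>i\<in>UNIV. if b i = b' i then 2 else 0)"
  proof (intro prod.cong refl)
    fix i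
    have "b i \<in> {0, 1}" "b' i \<in> {0, 1}" using UNIV_qubit by blast+
    then show "(\<Sum>t\<in>UNIV. ?g i t) = (if b i = b' i then 2 else 0)"
      by (auto simp: UNIV_qubit qubit_sign_def)
  qed
  also have "\<dots> = (if b = b' then of_nat CARD('n \<Rightarrow> 2) else 0)"
    by (auto simp: fun_eq_iff card_fun)
  finally show ?thesis .
qed

text \<open>Closed form of the measurement on Bob's side with the reference untouched;
  \<open>id_tensor_measurement\<close> makes the identification.\<close>

definition dephase :: "('e::finite \<times> 'b::finite) operator \<Rightarrow> ('e \<times> 'b) operator" where
  "dephase \<rho> = (\<chi> p q. if snd p = snd q then \<rho> $ p $ q else 0)"

lemma trace_dephase: "trace (dephase \<rho>) = trace \<rho>"
  by (simp add: dephase_def trace_def)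

lemma dephase_hermitian: "dagger \<rho> = \<rho> \<Longrightarrow> dagger (dephase \<rho>) = dephase \<rho>"
  by (auto simp: dephase_def dagger_def vec_eq_iff)

text \<open>Cancelling the term \<open>z = 0\<close> of the average over sign conjugations against
  \<open>\<rho>\<close> leaves a difference \<open>?P - ?Q\<close> of positive operators, each of
  trace \<open>(d - 1) / d\<close>.\<close>

lemma trace_norm_dephase_le:
  fixes \<rho> :: "('e::finite \<times> ('n::finite \<Rightarrow> 2)) operator"
  assumes \<rho>: "\<rho> \<in> states"
  shows "trace_norm (\<rho> - dephase \<rho>) \<le> 2 * (real CARD('n \<Rightarrow> 2) - 1) / real CARD('n \<Rightarrow> 2)"
proof -
  define d where "d = real CARD('n \<Rightarrow> 2)"
  have d1: "d \<ge> 1" by (simp add: d_def Suc_leI)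
  let ?Z = "\<lambda>z. \<chi> p q. character z (snd p) * \<rho> $ p $ q * cnj (character z (snd q))"
  let ?P = "op_scale (of_real (1 - 1 / d)) \<rho>"
  let ?Q = "\<Sum>z\<in>UNIV - {\<lambda>_. 0}. op_scale (of_real (1 / d)) (?Z z)"
  have psd: "psd \<rho>" and tr: "trace \<rho> = 1" using \<rho> by (simp_all add: states_def)
  have "psd ?P" using d1 by (intro psd_scale psd) simp
  moreover have "psd ?Q"
    using d1 psd_congruence[OF psd, of _ "\<lambda>p. p"] by (intro psd_sum psd_scale) auto
  moreover have "\<rho> - dephase \<rho> = ?P - ?Q"
  proof -
    have "(\<rho> - dephase \<rho>) $ p $ q = (?P - ?Q) $ p $ q" for p q
    proof -
      let ?c = "\<lambda>z. character z (snd p) * character z (snd q)"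
      have "?Q $ p $ q = (\<Sum>z\<in>UNIV - {\<lambda>_. 0}. ?c z) * \<rho> $ p $ q / of_real d"
        by (simp add: op_scale_def cnj_character sum_distrib_left sum_distrib_right sum_divide_distrib ac_simps)
      \<comment> \<open>The omitted index is the trivial character, which contributes exactly
        1.\<close>
      also have "(\<Sum>z\<in>UNIV - {\<lambda>_. 0}. ?c z) = (\<Sum>z\<in>UNIV. ?c z) - 1"
        by (subst sum_diff) (simp_all add: character_zero)
      also have "\<dots> = (if snd p = snd q then of_real d else 0) - 1"
        by (simp add: character_orthogonality d_def)
      finally show ?thesis
        using d1 by (auto simp: op_scale_def dephase_def field_simps)
    qed
    then show ?thesis by (simp add: vec_eq_iff)
  qed
  ultimately have "trace_norm (\<rho> - dephase \<rho>) \<le> Re (trace ?P) + Re (trace ?Q)"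
    by (simp only: trace_norm_diff_le)
  also have "trace ?P = of_real (1 - 1 / d)" by (simp add: trace_op_scale tr)
  also have "trace ?Q = of_real ((d - 1) / d)"
  proof -
    have "trace (?Z z) = 1" for z
      using tr by (simp add: trace_def cnj_character mult.assoc mult.commute[of "\<rho> $ _ $ _"])
        (simp add: mult.assoc[symmetric] character_square)
    then have "trace ?Q = of_nat (card (UNIV - {\<lambda>_::'n. 0::2})) * of_real (1 / d)"
      by (simp add: trace_sum trace_op_scale)
    also have "card (UNIV - {\<lambda>_::'n. 0::2}) = CARD('n \<Rightarrow> 2) - 1"
      by (simp add: card_Diff_singleton)
    finally show ?thesis by (simp add: d_def of_nat_diff Suc_leI)
  qed
  also have "Re (of_real (1 - 1 / d)) + Re (of_real ((d - 1) / d)) = 2 * (d - 1) / d"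
    using d1 by (simp add: field_simps)
  finally show ?thesis by (simp add: d_def)
qed

text \<open>The overlap of the state with its dephasing is the sum of the squared outcome
  probabilities, \<open>d\<close> times \<open>1 / d^2\<close>; since the difference is traceless,
  \<open>trace_norm_ge\<close> yields \<open>2 (1 - 1 / d)\<close>.\<close>

lemma trace_norm_dephase_ge:
  fixes \<psi> :: "complex ^ ('e::finite \<times> 'b::finite)"
  assumes psi: "sesq \<psi> \<psi> = 1" and mixed: "ptrace_fst (ketbra \<psi> \<psi>) = max_mixed"
  shows "2 * (real CARD('b) - 1) / real CARD('b) \<le>
    trace_norm (ketbra \<psi> \<psi> - dephase (ketbra \<psi> \<psi>))"
proof -
  let ?\<rho> = "ketbra \<psi> \<psi>"
  have H: "dagger ?\<rho> = ?\<rho>" by (simp add: psd_hermitian psd_ketbra)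
  \<comment> \<open>Each measurement outcome \<open>b\<close> has probability
    \<open>1 / d\<close>.\<close>
  have m: "(\<Sum>e\<in>UNIV. \<psi> $ (e, b) * cnj (\<psi> $ (e, b))) = 1 / of_nat CARD('b)" for b
    using arg_cong[OF mixed, of "\<lambda>A. A $ b $ b"]
    by (simp add: ptrace_fst_def ketbra_def max_mixed_def mat_def)
  have "sesq \<psi> (dephase ?\<rho> *v \<psi>)
      = (\<Sum>e\<in>UNIV. \<Sum>b\<in>UNIV. \<Sum>e'\<in>UNIV. \<Sum>b'\<in>UNIV. if b = b' then
          (\<psi> $ (e, b) * cnj (\<psi> $ (e, b))) * (\<psi> $ (e', b') * cnj (\<psi> $ (e', b'))) else 0)"
    unfolding sesq_matrix_vector sum_UNIV_Times
    by (intro sum.cong refl) (simp add: dephase_def ketbra_def)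
  also have "\<dots> = (\<Sum>e\<in>UNIV. \<Sum>b\<in>UNIV. (\<psi> $ (e, b) * cnj (\<psi> $ (e, b))) *
      (\<Sum>e'\<in>UNIV. \<psi> $ (e', b) * cnj (\<psi> $ (e', b))))"
    by (simp add: sum_distrib_left)
  also have "\<dots> = (\<Sum>e\<in>UNIV. \<Sum>b\<in>UNIV. (\<psi> $ (e, b) * cnj (\<psi> $ (e, b))) * (1 / of_nat CARD('b)))"
    unfolding m ..
  also have "\<dots> = (\<Sum>b\<in>UNIV. \<Sum>e\<in>UNIV. (\<psi> $ (e, b) * cnj (\<psi> $ (e, b))) * (1 / of_nat CARD('b)))"
    by (rule sum.swap)
  also have "\<dots> = of_real (1 / real CARD('b))"
    unfolding sum_distrib_right[symmetric] m by simp
  finally have "Re (sesq \<psi> (dephase ?\<rho> *v \<psi>)) = 1 / real CARD('b)"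
    by (simp only: Re_complex_of_real)
  moreover have "sesq \<psi> (?\<rho> *v \<psi>) = 1" by (simp add: sesq_ketbra psi)
  moreover have "2 * Re (sesq \<psi> ((?\<rho> - dephase ?\<rho>) *v \<psi>)) - Re (trace (?\<rho> - dephase ?\<rho>))
      \<le> trace_norm (?\<rho> - dephase ?\<rho>)"
    by (intro trace_norm_ge psi) (simp add: dagger_diff H dephase_hermitian)
  moreover have "trace (?\<rho> - dephase ?\<rho>) = 0" by (simp add: trace_sub trace_dephase)
  ultimately show ?thesis
    by (simp add: matrix_vector_mult_diff_rdistrib sesq_simps diff_divide_distrib)
qed

section \<open>Entrywise formulas for the tensor powers of the two channels\<close>

text \<open>Covers both channels: each output entry is a scalar times one input entry, with
  \<open>g\<close> a Kronecker delta for the measurement and \<open>f\<close> a permutation of basis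
  states for CNOT.\<close>

lemma map_power_entry:
  fixes F :: "'x::finite operator \<Rightarrow> 'y::finite operator" and \<rho> :: "('n::finite \<Rightarrow> 'x) operator"
  assumes F: "\<And>\<rho> p q. F \<rho> $ p $ q = g p q * \<rho> $ f p $ f q"
  shows "map_power F \<rho> $ y $ y' = (\<Prod>i\<in>UNIV. g (y i) (y' i)) * \<rho> $ (\<lambda>i. f (y i)) $ (\<lambda>i. f (y' i))"
proof -
  have u: "(\<Prod>i\<in>UNIV. matrix_unit (x i) (x' i) $ f (y i) $ f (y' i))
      = (if x' = (\<lambda>i. f (y' i)) then if x = (\<lambda>i. f (y i)) then 1 else 0 else 0)" for x x' :: "'n \<Rightarrow> 'x"
  proof -
    have "matrix_unit (x i) (x' i) $ f (y i) $ f (y' i)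
        = (if x i = f (y i) \<and> x' i = f (y' i) then 1 else 0)" for i
      by (auto simp: matrix_unit_def ketbra_def axis_def)
    then show ?thesis by (auto simp: fun_eq_iff)
  qed
  have "map_power F \<rho> $ y $ y' = (\<Sum>x\<in>UNIV. \<Sum>x'\<in>UNIV.
      if x' = (\<lambda>i. f (y' i)) then if x = (\<lambda>i. f (y i)) then
        (\<Prod>i\<in>UNIV. g (y i) (y' i)) * \<rho> $ x $ x' else 0 else 0)"
    unfolding map_power_def sum_component op_scale_def op_tensor_def vec_lambda_beta F prod.distrib u
    by (intro sum.cong refl) simp
  then show ?thesis by simp
qed

lemma measurement_channel_entry:
  "measurement_channel \<rho> $ p $ q = (if p = q then 1 else 0) * \<rho> $ p $ q"
proof -
  have pq: "p \<in> {0, 1}" "q \<in> {0, 1}" using UNIV_qubit by blast+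
  have b: "basis_proj i $ j $ k = (if j = i \<and> k = i then 1 else 0)" for i j k
    by (auto simp: basis_proj_def ketbra_def axis_def)
  show ?thesis using pq
    by (auto simp: measurement_channel_def matrix_matrix_mult_def UNIV_qubit b)
qed

lemma map_power_measurement_channel:
  fixes \<rho> :: "('n::finite \<Rightarrow> 2) operator"
  shows "map_power measurement_channel \<rho> $ b $ b' = (if b = b' then \<rho> $ b $ b' else 0)"
  by (subst map_power_entry[OF measurement_channel_entry]) (auto simp: fun_eq_iff)

lemma id_tensor_measurement: "id_tensor (map_power measurement_channel) = dephase"
  by (simp add: fun_eq_iff vec_eq_iff id_tensor_def map_power_measurement_channel dephase_def)

text \<open>CNOT is a self-inverse permutation matrix, so rows and columns are reindexed alike. The
  literal factor 1 fits the shape required by \<open>map_power_entry\<close>.\<close>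

lemma cnot_channel_entry:
  "cnot_channel \<rho> $ p $ q
    = 1 * \<rho> $ (fst p + snd p, snd p) $ (fst q + snd q, snd q)"
proof -
  have c: "cnot $ p $ q = (if q = (fst p + snd p, snd p) then 1 else 0)" for p q
    by (auto simp: cnot_def qubit_add_add prod_eq_iff)
  have c': "cnot $ q $ p = (if q = (fst p + snd p, snd p) then 1 else 0)" for p q
    by (auto simp: cnot_def)
  have "cnot_channel \<rho> $ p $ q = (\<Sum>s\<in>UNIV. (\<Sum>r\<in>UNIV. cnot $ p $ r * \<rho> $ r $ s) * cnot $ s $ q)"
    by (simp add: cnot_channel_def matrix_matrix_mult_def)
  also have "\<dots> = (\<Sum>s\<in>UNIV. if s = (fst q + snd q, snd q) then
      (\<Sum>r\<in>UNIV. if r = (fst p + snd p, snd p) then \<rho> $ r $ s else 0) else 0)"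
    by (intro sum.cong refl) (simp add: c[of p] c'[of _ q] if_distrib[of "\<lambda>x. x * _"] cong: if_cong)
  also have "\<dots> = \<rho> $ (fst p + snd p, snd p) $ (fst q + snd q, snd q)" by simp
  finally show ?thesis by simp
qed

lemma bipartite_power_cnot:
  fixes \<rho> :: "(('n::finite \<Rightarrow> 2) \<times> ('n \<Rightarrow> 2)) operator"
  shows "bipartite_power cnot_channel \<rho> $ (a, b) $ (a', b')
    = \<rho> $ (\<lambda>i. a i + b i, b) $ (\<lambda>i. a' i + b' i, b')"
  by (simp add: bipartite_power_def split_systems_def merge_systems_def
      map_power_entry[OF cnot_channel_entry] comp_def)



section \<open>Channels on part of a system\<close>

lemma vector_space_op_scale: "vector_space op_scale"
  by unfold_locales (simp_all add: op_scale_def vec_eq_iff algebra_simps)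

lemma linear_op_scale_iff:
  "Vector_Spaces.linear op_scale op_scale F \<longleftrightarrow>
    (\<forall>A B. F (A + B) = F A + F B) \<and> (\<forall>c A. F (op_scale c A) = op_scale c (F A))"
  by (auto simp: Vector_Spaces.linear_iff vector_space_op_scale)

text \<open>For complete positivity, the quadratic form of the dephased array is a sum over
  \<open>b\<close> of the original form at vectors restricted to coordinate
  \<open>b\<close>.\<close>

lemma dephasing_channel:
  fixes F :: "'x::finite operator \<Rightarrow> 'x operator"
  assumes F: "\<And>\<rho> b b'. F \<rho> $ b $ b' = (if b = b' then \<rho> $ b $ b' else 0)"
  shows "F \<in> channels"
proof -
  have "Vector_Spaces.linear op_scale op_scale F"
    by (simp add: linear_op_scale_iff vec_eq_iff F op_scale_def)
  moreover have "trace (F \<rho>) = trace \<rho>" for \<rho> by (simp add: trace_def F)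
  moreover have "completely_positive F"
    unfolding completely_positive_def block_psd_def
  proof (intro allI impI)
    fix k and R :: "nat \<Rightarrow> nat \<Rightarrow> 'x operator" and v :: "nat \<Rightarrow> complex ^ 'x"
    assume R: "\<forall>v. (\<Sum>i<k. \<Sum>j<k. sesq (v i) (R i j *v v j)) \<in> \<real>\<^sub>\<ge>\<^sub>0"
    have "sesq (v i) (F (R i j) *v v j)
        = (\<Sum>b\<in>UNIV. sesq (axis b (v i $ b)) (R i j *v axis b (v j $ b)))" for i j
    proof -
      have "sesq (v i) (F (R i j) *v v j) = (\<Sum>b\<in>UNIV. \<Sum>b'\<in>UNIV.
          if b = b' then cnj (v i $ b) * R i j $ b $ b * v j $ b else 0)"
        unfolding sesq_matrix_vector by (intro sum.cong refl) (simp add: F)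
      then show ?thesis by (simp add: sesq_axis matrix_vector_mult_axis mult.assoc)
    qed
    then have "(\<Sum>i<k. \<Sum>j<k. sesq (v i) (F (R i j) *v v j))
        = (\<Sum>i<k. \<Sum>b\<in>UNIV. \<Sum>j<k. sesq (axis b (v i $ b)) (R i j *v axis b (v j $ b)))"
      by (simp only:) (intro sum.cong refl sum.swap)
    also have "\<dots> = (\<Sum>b\<in>UNIV. \<Sum>i<k. \<Sum>j<k. sesq (axis b (v i $ b)) (R i j *v axis b (v j $ b)))"
      by (rule sum.swap)
    also have "\<dots> \<in> \<real>\<^sub>\<ge>\<^sub>0"
    proof -
      have "(\<Sum>i<k. \<Sum>j<k. sesq (axis b (v i $ b)) (R i j *v axis b (v j $ b))) \<in> \<real>\<^sub>\<ge>\<^sub>0" for b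
        using R[rule_format, of "\<lambda>i. axis b (v i $ b)"] .
      then show ?thesis by (simp add: complex_nonneg_Reals_iff sum_nonneg)
    qed
    finally show "(\<Sum>i<k. \<Sum>j<k. sesq (v i) (F (R i j) *v v j)) \<in> \<real>\<^sub>\<ge>\<^sub>0" .
  qed
  ultimately show ?thesis by (simp add: channels_def)
qed

text \<open>Counterpart of the arrays in \<open>block_psd\<close> for an ancilla indexed by a
  type.\<close>

definition block :: "('e::finite \<times> 'x::finite) operator \<Rightarrow> 'e \<Rightarrow> 'e \<Rightarrow> 'x operator" where
  "block \<rho> e e' = (\<chi> x x'. \<rho> $ (e, x) $ (e', x'))"

lemma sesq_block:
  "sesq v (\<rho> *v v) = (\<Sum>e\<in>UNIV. \<Sum>e'\<in>UNIV.
     sesq (\<chi> x. v $ (e, x)) (block \<rho> e e' *v (\<chi> x. v $ (e', x))))"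
proof -
  have "sesq v (\<rho> *v v) = (\<Sum>e\<in>UNIV. \<Sum>x\<in>UNIV. \<Sum>e'\<in>UNIV. \<Sum>x'\<in>UNIV.
      cnj (v $ (e, x)) * \<rho> $ (e, x) $ (e', x') * v $ (e', x'))"
    unfolding sesq_matrix_vector sum_UNIV_Times ..
  also have "\<dots> = (\<Sum>e\<in>UNIV. \<Sum>e'\<in>UNIV. \<Sum>x\<in>UNIV. \<Sum>x'\<in>UNIV.
      cnj (v $ (e, x)) * \<rho> $ (e, x) $ (e', x') * v $ (e', x'))"
    by (intro sum.cong refl sum.swap)
  finally show ?thesis by (simp add: sesq_matrix_vector block_def)
qed

lemma id_tensor_block: "id_tensor F \<rho> $ (e, y) $ (e', y') = F (block \<rho> e e') $ y $ y'"
  by (simp add: id_tensor_def block_def)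

text \<open>Bridge between an ancilla given by a finite type and the numbered ancillas over which
  \<open>completely_positive\<close> quantifies.\<close>

lemma psd_iff_block_psd:
  fixes \<rho> :: "('e::finite \<times> 'x::finite) operator"
  assumes h: "bij_betw h {..<k} (UNIV :: 'e set)"
  shows "psd \<rho> \<longleftrightarrow> block_psd k (\<lambda>i j. block \<rho> (h i) (h j))"
proof -
  let ?q = "\<lambda>w i. \<chi> x. w $ (h i, x)"
  have s: "sesq w (\<rho> *v w) = (\<Sum>i<k. \<Sum>j<k. sesq (?q w i) (block \<rho> (h i) (h j) *v ?q w j))" for w
    unfolding sesq_block by (simp only: sum.reindex_bij_betw[OF h, symmetric])
  show ?thesis
  proof
    assume \<rho>: "psd \<rho>"
    show "block_psd k (\<lambda>i j. block \<rho> (h i) (h j))"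
      unfolding block_psd_def
    proof
      fix v :: "nat \<Rightarrow> complex ^ 'x"
      \<comment> \<open>Glues the family \<open>v\<close> into one vector along the inverse of the
        enumeration \<open>h\<close>.\<close>
      define w where "w = (\<chi> p. v (the_inv_into {..<k} h (fst p)) $ snd p)"
      have "?q w i = v i" if "i < k" for i
        using h that by (simp add: w_def bij_betw_def the_inv_into_f_f vec_eq_iff)
      then have "sesq w (\<rho> *v w) = (\<Sum>i<k. \<Sum>j<k. sesq (v i) (block \<rho> (h i) (h j) *v v j))"
        unfolding s by (intro sum.cong refl) simp
      with \<rho> show "(\<Sum>i<k. \<Sum>j<k. sesq (v i) (block \<rho> (h i) (h j) *v v j)) \<in> \<real>\<^sub>\<ge>\<^sub>0"
        unfolding psd_def by metis
    qed
  next
    assume \<rho>: "block_psd k (\<lambda>i j. block \<rho> (h i) (h j))"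
    show "psd \<rho>"
      unfolding psd_def s by (intro allI \<rho>[unfolded block_psd_def, rule_format])
  qed
qed

text \<open>Positivity is complete positivity at ancilla dimension \<open>CARD('e)\<close>; the
  trace only sees the diagonal blocks, on each of which \<open>C\<close> preserves it.\<close>

lemma id_tensor_channel_state:
  fixes \<rho> :: "('e::finite \<times> 'x::finite) operator" and C :: "'x operator \<Rightarrow> 'y::finite operator"
  assumes C: "C \<in> channels" and \<rho>: "\<rho> \<in> states"
  shows "id_tensor C \<rho> \<in> states"
proof -
  obtain h where h: "bij_betw h {..<CARD('e)} (UNIV :: 'e set)"
    using ex_bij_betw_nat_finite[of "UNIV :: 'e set"] by (auto simp: atLeast0LessThan)
  have "block_psd CARD('e) (\<lambda>i j. block \<rho> (h i) (h j))"
    using \<rho> by (simp add: states_def psd_iff_block_psd[OF h])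
  then have "block_psd CARD('e) (\<lambda>i j. C (block \<rho> (h i) (h j)))"
    using C by (auto simp: channels_def completely_positive_def)
  moreover have "C (block \<rho> e e') = block (id_tensor C \<rho>) e e'" for e e'
    by (simp add: vec_eq_iff block_def[of "id_tensor C \<rho>"] id_tensor_block)
  ultimately have "psd (id_tensor C \<rho>)"
    by (simp add: psd_iff_block_psd[OF h])
  moreover have "trace (id_tensor C \<rho>) = (\<Sum>e\<in>UNIV. trace (C (block \<rho> e e)))"
    unfolding trace_def sum_UNIV_Times id_tensor_block ..
  then have "trace (id_tensor C \<rho>) = (\<Sum>e\<in>UNIV. trace (block \<rho> e e))"
    using C by (simp add: channels_def)
  then have "trace (id_tensor C \<rho>) = trace \<rho>"
    unfolding trace_def sum_UNIV_Times block_def by simp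
  ultimately show ?thesis using \<rho> by (simp add: states_def)
qed

section \<open>Bob's state with the reference, without and with the CNOT gates\<close>

definition discard_first ::
  "('e::finite \<times> ('a::finite \<times> 'b::finite)) operator \<Rightarrow> ('e \<times> 'b) operator" where
  "discard_first \<rho> = (\<chi> p q. \<Sum>a\<in>UNIV. \<rho> $ (fst p, (a, snd p)) $ (fst q, (a, snd q)))"

text \<open>The joint state of the reference and Bob after the CNOT gates, Alice's output being
  traced out.\<close>

definition cnot_reduced ::
  "('e::finite \<times> (('n::finite \<Rightarrow> 2) \<times> ('n \<Rightarrow> 2))) operator \<Rightarrow> ('e \<times> ('n \<Rightarrow> 2)) operator" where
  "cnot_reduced \<rho> = (\<chi> p q. \<Sum>a\<in>UNIV.
     \<rho> $ (fst p, (\<lambda>i. a i + snd p i, snd p)) $ (fst q, (\<lambda>i. a i + snd q i, snd q)))"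

lemma psd_reindex:
  assumes "psd A"
  shows "psd (\<chi> p q. A $ f p $ f q)"
  using psd_congruence[OF assms, of "\<lambda>_. 1" f] by simp

lemma sum_translate:
  fixes f :: "('n \<Rightarrow> 2) \<Rightarrow> 'a::comm_monoid_add"
  shows "(\<Sum>a\<in>UNIV. f (\<lambda>i. a i + b i)) = (\<Sum>a\<in>UNIV. f a)"
  by (rule sum.reindex_bij_witness[where i = "\<lambda>a i. a i + b i" and j = "\<lambda>a i. a i + b i"])
    (auto simp: qubit_add_add)

lemma discard_first_state:
  assumes "\<rho> \<in> states"
  shows "discard_first \<rho> \<in> states"
proof -
  have "discard_first \<rho> = (\<Sum>a\<in>UNIV. \<chi> p q. \<rho> $ (fst p, (a, snd p)) $ (fst q, (a, snd q)))"
    by (simp add: discard_first_def vec_eq_iff)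
  then have "psd (discard_first \<rho>)"
    using assms by (auto simp: states_def intro!: psd_sum psd_reindex[of \<rho>])
  moreover have "trace (discard_first \<rho>) = trace \<rho>"
    unfolding trace_def sum_UNIV_Times
    by (simp add: discard_first_def) (intro sum.cong refl sum.swap)
  ultimately show ?thesis using assms by (simp add: states_def)
qed

lemma cnot_reduced_state:
  assumes "\<rho> \<in> states"
  shows "cnot_reduced \<rho> \<in> states"
proof -
  have "cnot_reduced \<rho> = (\<Sum>a\<in>UNIV. \<chi> p q.
      \<rho> $ (fst p, (\<lambda>i. a i + snd p i, snd p)) $ (fst q, (\<lambda>i. a i + snd q i, snd q)))"
    by (simp add: cnot_reduced_def vec_eq_iff)
  then have "psd (cnot_reduced \<rho>)"
    using assms by (auto simp: states_def intro!: psd_sum psd_reindex[of \<rho>])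
  \<comment> \<open>On the diagonal both shifts are by the same string and disappear in the sum over
    \<open>a\<close>.\<close>
  moreover have "trace (cnot_reduced \<rho>) = trace (discard_first \<rho>)"
    by (simp add: trace_def cnot_reduced_def discard_first_def
        sum_translate[of "\<lambda>a. \<rho> $ (_, (a, _)) $ (_, (a, _))"])
  ultimately show ?thesis using assms discard_first_state[OF assms] by (simp add: states_def)
qed

text \<open>Turns each diamond norm below into a comparison of two operators on the reference and
  Bob, which are states if \<open>\<rho>\<close> is a state and \<open>C\<close> a channel.\<close>

lemma id_tensor_signalling_difference:
  "id_tensor (\<lambda>\<rho>. ptrace_fst (bipartite_power cnot_channel \<rho>) - C (ptrace_fst \<rho>)) \<rho>
    = cnot_reduced \<rho> - id_tensor C (discard_first \<rho>)"
proof -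
  have "ptrace_fst (\<chi> x x'. \<rho> $ (e, x) $ (e', x')) = (\<chi> b b'. discard_first \<rho> $ (e, b) $ (e', b'))"
    for e e'
    by (simp add: ptrace_fst_def discard_first_def vec_eq_iff)
  then show ?thesis
    by (simp add: id_tensor_def vec_eq_iff cnot_reduced_def)
      (simp add: ptrace_fst_def bipartite_power_cnot)
qed

text \<open>Entries surviving the dephasing have equal Bob indices, so both shifts of
  \<open>a\<close> coincide and the sum over \<open>a\<close> absorbs them: Alice's influence is
  confined to the coherences.\<close>

lemma dephase_discard_first: "dephase (cnot_reduced \<rho>) = dephase (discard_first \<rho>)"
  by (auto simp: dephase_def cnot_reduced_def discard_first_def vec_eq_iff
      sum_translate[of "\<lambda>a. \<rho> $ (_, (a, _)) $ (_, (a, _))"])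

text \<open>Two states are at trace distance at most 2. Boundedness is what makes the supremum in
  \<open>diamond_norm\<close> an upper bound for its members.\<close>

lemma bdd_above_signalling:
  fixes C :: "('n::finite \<Rightarrow> 2) operator \<Rightarrow> ('n \<Rightarrow> 2) operator"
  assumes "C \<in> channels"
  shows "bdd_above ((\<lambda>\<rho>. trace_norm (id_tensor
    (\<lambda>\<rho>. ptrace_fst (bipartite_power cnot_channel \<rho>) - C (ptrace_fst \<rho>)) \<rho>)) `
    (states :: ('e::finite \<times> (('n \<Rightarrow> 2) \<times> ('n \<Rightarrow> 2))) operator set))"
proof (rule bdd_aboveI2)
  fix \<rho> :: "('e \<times> (('n \<Rightarrow> 2) \<times> ('n \<Rightarrow> 2))) operator"
  assume \<rho>: "\<rho> \<in> states"
  have "cnot_reduced \<rho> \<in> states" "id_tensor C (discard_first \<rho>) \<in> states"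
    using \<rho> assms by (simp_all add: cnot_reduced_state id_tensor_channel_state discard_first_state)
  then show "trace_norm (id_tensor
      (\<lambda>\<rho>. ptrace_fst (bipartite_power cnot_channel \<rho>) - C (ptrace_fst \<rho>)) \<rho>) \<le> 2"
    unfolding id_tensor_signalling_difference states_def
    using trace_norm_diff_le[of "cnot_reduced \<rho>" "id_tensor C (discard_first \<rho>)"] by simp
qed

text \<open>With the measurement as comparison channel, the difference is
  \<open>cnot_reduced \<rho>\<close> minus its own dephasing.\<close>

lemma diamond_norm_measurement_le:
  "diamond_norm (\<lambda>\<rho> :: (('n::finite \<Rightarrow> 2) \<times> ('n \<Rightarrow> 2)) operator.
      ptrace_fst (bipartite_power cnot_channel \<rho>) - map_power measurement_channel (ptrace_fst \<rho>))
    \<le> 2 * (real CARD('n \<Rightarrow> 2) - 1) / real CARD('n \<Rightarrow> 2)"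
  unfolding diamond_norm_def id_tensor_signalling_difference id_tensor_measurement
    dephase_discard_first[symmetric]
  by (intro cSUP_least states_nonempty trace_norm_dephase_le cnot_reduced_state)


section \<open>The signalling of CNOT\<close>

text \<open>Phase kickback: if Alice inputs the character \<open>z\<close> and Bob's input is maximally entangled with
  the reference, then the output is one of \<open>d\<close> orthogonal states, labelled by \<open>z\<close>, while the input
  of \<open>C\<close> does not depend on \<open>z\<close>.  On average over \<open>z\<close> the output of \<open>C\<close> has overlap at most \<open>1 / d\<close>
  with these states.\<close>

lemma diamond_norm_signalling_ge:
  fixes C :: "('n::finite \<Rightarrow> 2) operator \<Rightarrow> ('n \<Rightarrow> 2) operator"
  assumes C: "C \<in> channels"
  shows "2 * (real CARD('n \<Rightarrow> 2) - 1) / real CARD('n \<Rightarrow> 2)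
    \<le> diamond_norm (\<lambda>\<rho>. ptrace_fst (bipartite_power cnot_channel \<rho>) - C (ptrace_fst \<rho>))"
    (is "_ \<le> ?D")
proof -
  define d where "d = real CARD('n \<Rightarrow> 2)"
  have d1: "d \<ge> 1" by (simp add: d_def Suc_leI)
  have dC: "of_nat CARD('n \<Rightarrow> 2) = complex_of_real d" by (simp add: d_def)
  define s where "s = complex_of_real (sqrt d)"
  have ss: "s * s = of_real d" "cnj s = s" "s \<noteq> 0"
    using d1 by (simp_all add: s_def of_real_mult[symmetric] del: of_real_mult)
  define \<psi> :: "('n \<Rightarrow> 2) \<Rightarrow> complex ^ ((('n \<Rightarrow> 2) \<times> ('n \<Rightarrow> 2)) \<times> (('n \<Rightarrow> 2) \<times> ('n \<Rightarrow> 2)))"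
    where "\<psi> z = (\<chi> p. if fst p = (\<lambda>_. 0, snd (snd p)) then character z (fst (snd p)) / of_real d else 0)"
    for z
  \<comment> \<open>The sign now sits on Bob's basis states.\<close>
  define \<phi> :: "('n \<Rightarrow> 2) \<Rightarrow> complex ^ ((('n \<Rightarrow> 2) \<times> ('n \<Rightarrow> 2)) \<times> ('n \<Rightarrow> 2))"
    where "\<phi> z = (\<chi> p. if fst p = (\<lambda>_. 0, snd p) then character z (snd p) / s else 0)" for z
  define \<tau> where "\<tau> = id_tensor C (discard_first (ketbra (\<psi> (\<lambda>_. 0)) (\<psi> (\<lambda>_. 0))))"
  have sum_diag: "(\<Sum>e\<in>UNIV. \<Sum>b\<in>UNIV. if e = (\<lambda>_ :: 'n. 0 :: 2, b) then f b else 0) = (\<Sum>b\<in>UNIV. f b)"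
    for f :: "('n \<Rightarrow> 2) \<Rightarrow> complex"
    by (subst sum.swap) simp
  have psi1: "sesq (\<psi> z) (\<psi> z) = 1" for z
  proof -
    have "sesq (\<psi> z) (\<psi> z) =
      (\<Sum>e\<in>(UNIV :: (('n \<Rightarrow> 2) \<times> ('n \<Rightarrow> 2)) set). \<Sum>a\<in>(UNIV :: ('n \<Rightarrow> 2) set). \<Sum>b\<in>UNIV.
        if e = (\<lambda>_. 0, b) then 1 / (of_real d * of_real d) else 0)"
      unfolding sesq_def sum_UNIV_Times[of "\<lambda>p. cnj (\<psi> z $ p) * _ p"]
        sum_UNIV_Times[of "\<lambda>p. cnj (\<psi> z $ (_, p)) * _ p"]
      by (intro sum.cong refl) (simp add: \<psi>_def cnj_character character_square)
    also have "\<dots> = (\<Sum>a\<in>(UNIV :: ('n \<Rightarrow> 2) set). \<Sum>b\<in>(UNIV :: ('n \<Rightarrow> 2) set). 1 / (of_real d * of_real d))"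
      by (subst sum.swap) (simp only: sum_diag)
    finally show ?thesis using d1 by (simp add: d_def)
  qed
  have phi1: "sesq (\<phi> z) (\<phi> z) = 1" for z
  proof -
    have "sesq (\<phi> z) (\<phi> z) =
      (\<Sum>e\<in>(UNIV :: (('n \<Rightarrow> 2) \<times> ('n \<Rightarrow> 2)) set). \<Sum>b\<in>UNIV. if e = (\<lambda>_. 0, b) then 1 / of_real d else 0)"
      unfolding sesq_def sum_UNIV_Times[of "\<lambda>p. cnj (\<phi> z $ p) * _ p"]
      by (intro sum.cong refl) (simp add: \<phi>_def cnj_character character_square ss)
    then show ?thesis using d1 by (simp add: sum_diag d_def)
  qed
  \<comment> \<open>Shifting \<open>a\<close> by \<open>b\<close> releases the factor
    \<open>character z b\<close>; the factors in \<open>a\<close> square to 1, and the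
    \<open>d\<close> equal terms turn \<open>1 / d^2\<close> into \<open>1 / d\<close>.\<close>
  have out: "cnot_reduced (ketbra (\<psi> z) (\<psi> z)) = ketbra (\<phi> z) (\<phi> z)" for z
  proof -
    have "cnot_reduced (ketbra (\<psi> z) (\<psi> z)) $ p $ q = ketbra (\<phi> z) (\<phi> z) $ p $ q" for p q
    proof -
      have e: "character z a * character z b * (character z a * character z b') = character z b * character z b'"
        for a b b' using character_square[of z a] by (simp add: ac_simps)
      show ?thesis using d1
        by (simp add: e cnot_reduced_def ketbra_def \<psi>_def \<phi>_def cnj_character character_add ss dC)
    qed
    then show ?thesis by (simp add: vec_eq_iff)
  qed
  have ref: "discard_first (ketbra (\<psi> z) (\<psi> z)) = discard_first (ketbra (\<psi> (\<lambda>_. 0)) (\<psi> (\<lambda>_. 0)))" for z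
  proof -
    have "discard_first (ketbra (\<psi> z) (\<psi> z)) $ p $ q
        = (if fst p = (\<lambda>_. 0, snd p)
           then if fst q = (\<lambda>_. 0, snd q) then 1 / of_real d else 0 else 0)" for z p q
      using d1 by (simp add: discard_first_def ketbra_def \<psi>_def cnj_character character_square dC)
    from this[of z] this[of "\<lambda>_. 0"] show ?thesis by (simp add: vec_eq_iff del: split_paired_All)
  qed
  have tau: "psd \<tau>" "trace \<tau> = 1"
    using id_tensor_channel_state[OF C discard_first_state[OF ketbra_state[OF psi1]]]
    by (simp_all add: \<tau>_def states_def)
  \<comment> \<open>The traceless difference of output states is tested against
    \<open>\<phi> z\<close> itself.\<close>
  have each: "2 * (1 - Re (sesq (\<phi> z) (\<tau> *v \<phi> z))) \<le> ?D" for z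
  proof -
    let ?X = "ketbra (\<phi> z) (\<phi> z) - \<tau>"
    have X: "?X = id_tensor
        (\<lambda>\<rho>. ptrace_fst (bipartite_power cnot_channel \<rho>) - C (ptrace_fst \<rho>)) (ketbra (\<psi> z) (\<psi> z))"
      unfolding id_tensor_signalling_difference by (simp add: out ref[of z] \<tau>_def)
    have "2 * Re (sesq (\<phi> z) (?X *v \<phi> z)) - Re (trace ?X) \<le> trace_norm ?X"
      by (intro trace_norm_ge phi1) (simp add: dagger_diff psd_hermitian psd_ketbra tau)
    moreover have "trace_norm ?X \<le> ?D"
      unfolding X diamond_norm_def
      by (intro cSUP_upper ketbra_state psi1 bdd_above_signalling C)
    ultimately show ?thesis
      by (simp add: matrix_vector_mult_diff_rdistrib sesq_simps sesq_ketbra phi1 trace_sub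
          trace_ketbra tau)
  qed
  \<comment> \<open>By character orthogonality the projections onto the \<open>\<phi> z\<close> add
    up to the projection onto the basis vectors in which the reference copies Bob's string. The
    overlaps thus sum to part of the diagonal of \<open>\<tau>\<close>, at most
    \<open>trace \<tau> = 1\<close>.\<close>
  have "(\<Sum>z\<in>UNIV. sesq (\<phi> z) (\<tau> *v \<phi> z))
      = (\<Sum>p\<in>UNIV. \<Sum>q\<in>UNIV. \<Sum>z\<in>UNIV. cnj (\<phi> z $ p) * \<tau> $ p $ q * \<phi> z $ q)"
    unfolding sesq_matrix_vector by (subst sum.swap) (intro sum.cong refl sum.swap)
  also have "\<dots> = (\<Sum>p\<in>UNIV. \<Sum>q\<in>UNIV. if q = p then if fst p = (\<lambda>_. 0, snd p) then \<tau> $ p $ p else 0 else 0)"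
  proof (intro sum.cong refl)
    fix p q
    have "(\<Sum>z\<in>UNIV. cnj (\<phi> z $ p) * \<tau> $ p $ q * \<phi> z $ q) =
        (if fst p = (\<lambda>_. 0, snd p) then if fst q = (\<lambda>_. 0, snd q) then
          \<tau> $ p $ q / of_real d * (\<Sum>z\<in>UNIV. character z (snd p) * character z (snd q))
          else 0 else 0)"
      by (simp add: \<phi>_def cnj_character ss(2) ss(1)[symmetric] sum_distrib_left ac_simps)
    moreover have "snd p \<noteq> snd q" if "q \<noteq> p" "fst p = (\<lambda>_. 0, snd p)" "fst q = (\<lambda>_. 0, snd q)"
      using that by (metis prod_eqI)
    ultimately show "(\<Sum>z\<in>UNIV. cnj (\<phi> z $ p) * \<tau> $ p $ q * \<phi> z $ q) =
        (if q = p then if fst p = (\<lambda>_. 0, snd p) then \<tau> $ p $ p else 0 else 0)"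
      using d1 by (cases "q = p") (simp_all add: character_orthogonality dC)
  qed
  also have "\<dots> = (\<Sum>p\<in>UNIV. if fst p = (\<lambda>_. 0, snd p) then \<tau> $ p $ p else 0)"
    by simp
  finally have "(\<Sum>z\<in>UNIV. Re (sesq (\<phi> z) (\<tau> *v \<phi> z)))
      = (\<Sum>p\<in>UNIV. Re (if fst p = (\<lambda>_. 0, snd p) then \<tau> $ p $ p else 0))"
    by (simp only: Re_sum[symmetric])
  also have "\<dots> \<le> (\<Sum>p\<in>UNIV. Re (\<tau> $ p $ p))"
    by (intro sum_mono) (simp add: psd_diagonal tau)
  also have "\<dots> = 1" using tau by (simp add: trace_def Re_sum[symmetric] del: Re_sum)
  finally have "(\<Sum>z\<in>UNIV. Re (sesq (\<phi> z) (\<tau> *v \<phi> z))) \<le> 1" .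
  moreover have "(\<Sum>z\<in>UNIV. 2 * (1 - Re (sesq (\<phi> z) (\<tau> *v \<phi> z)))) \<le> (\<Sum>z\<in>(UNIV :: ('n \<Rightarrow> 2) set). ?D)"
    by (intro sum_mono each)
  ultimately have "2 * (d - 1) \<le> d * ?D"
    by (simp add: sum_distrib_left[symmetric] sum_subtractf d_def)
  then show ?thesis using d1 by (simp add: d_def divide_le_eq mult.commute)
qed

lemma signalling_cnot:
  "signalling (bipartite_power cnot_channel ::
      (('n::finite \<Rightarrow> 2) \<times> ('n \<Rightarrow> 2)) operator \<Rightarrow> (('n \<Rightarrow> 2) \<times> ('n \<Rightarrow> 2)) operator)
    = 2 * (real CARD('n \<Rightarrow> 2) - 1) / real CARD('n \<Rightarrow> 2)"
proof (rule antisym)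
  have M: "(map_power measurement_channel :: ('n \<Rightarrow> 2) operator \<Rightarrow> _) \<in> channels"
    by (rule dephasing_channel) (rule map_power_measurement_channel)
  show "signalling (bipartite_power cnot_channel ::
      (('n \<Rightarrow> 2) \<times> ('n \<Rightarrow> 2)) operator \<Rightarrow> (('n \<Rightarrow> 2) \<times> ('n \<Rightarrow> 2)) operator)
    \<le> 2 * (real CARD('n \<Rightarrow> 2) - 1) / real CARD('n \<Rightarrow> 2)"
    unfolding signalling_def
    \<comment> \<open>The lower bound for all channels also supplies the boundedness needed to place
      the infimum below its member at the measurement.\<close>
    by (rule cINF_lower2, rule bdd_belowI2, erule diamond_norm_signalling_ge, rule M,
        rule diamond_norm_measurement_le)
  show "2 * (real CARD('n \<Rightarrow> 2) - 1) / real CARD('n \<Rightarrow> 2)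
    \<le> signalling (bipartite_power cnot_channel ::
      (('n \<Rightarrow> 2) \<times> ('n \<Rightarrow> 2)) operator \<Rightarrow> (('n \<Rightarrow> 2) \<times> ('n \<Rightarrow> 2)) operator)"
    unfolding signalling_def using M by (intro cINF_greatest diamond_norm_signalling_ge) auto
qed

text \<open>Supplies a state attaining the maximum: the normalised sum of the vectors
  \<open>|x, x>\<close>.\<close>

lemma maximally_entangled_exists:
  "\<exists>\<rho> :: ('x::finite \<times> 'x) operator. maximally_entangled \<rho>"
proof -
  define s where "s = complex_of_real (sqrt (real CARD('x)))"
  have ss: "s * s = of_nat CARD('x)" "cnj s = s"
    by (simp_all add: s_def of_real_mult[symmetric] del: of_real_mult)
  define \<psi> :: "complex ^ ('x \<times> 'x)" where "\<psi> = (\<chi> p. if fst p = snd p then 1 / s else 0)"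
  have k: "ketbra \<psi> \<psi> $ p $ q
      = (if fst p = snd p then if fst q = snd q then 1 / of_nat CARD('x) else 0 else 0)" for p q
    by (simp add: ketbra_def \<psi>_def ss)
  have "sesq \<psi> \<psi> = (\<Sum>e\<in>UNIV. \<Sum>b\<in>UNIV. ketbra \<psi> \<psi> $ (e, b) $ (e, b))"
    unfolding trace_ketbra[symmetric] trace_def sum_UNIV_Times ..
  then have "sesq \<psi> \<psi> = 1" by (simp add: k)
  moreover have "ptrace_fst (ketbra \<psi> \<psi>) = max_mixed" "ptrace_snd (ketbra \<psi> \<psi>) = max_mixed"
    by (simp_all add: ptrace_fst_def ptrace_snd_def k max_mixed_def mat_def vec_eq_iff)
  ultimately show ?thesis by (auto simp: maximally_entangled_def pure_state_def)
qed

theorem theorem3p4: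
  fixes Sigma :: real
    and deviation :: "(('n::finite \<Rightarrow> 2) \<times> ('n \<Rightarrow> 2)) operator \<Rightarrow> real"
  defines "Sigma \<equiv> signalling
      (bipartite_power cnot_channel ::
         (('n \<Rightarrow> 2) \<times> ('n \<Rightarrow> 2)) operator \<Rightarrow> (('n \<Rightarrow> 2) \<times> ('n \<Rightarrow> 2)) operator)"
    and "deviation \<equiv> \<lambda>\<rho>. trace_norm (\<rho> - id_tensor (map_power measurement_channel) \<rho>)"
  shows "Sigma = 2 * (real CARD('n \<Rightarrow> 2) - 1) / real CARD('n \<Rightarrow> 2) \<and>
         Sigma = 2 * (2 ^ CARD('n) - 1) / 2 ^ CARD('n) \<and>
         (\<exists>\<rho>\<in>states. deviation \<rho> = Sigma) \<and>
         (\<forall>\<rho>\<in>states. deviation \<rho> \<le> Sigma) \<and>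
         (\<forall>\<rho>. maximally_entangled \<rho> \<longrightarrow> \<rho> \<in> states \<and> deviation \<rho> = Sigma)"
proof -
  have Sigma: "Sigma = 2 * (real CARD('n \<Rightarrow> 2) - 1) / real CARD('n \<Rightarrow> 2)"
    unfolding Sigma_def by (rule signalling_cnot)
  have upper: "deviation \<rho> \<le> Sigma" if "\<rho> \<in> states" for \<rho>
    unfolding deviation_def id_tensor_measurement Sigma by (rule trace_norm_dephase_le[OF that])
  have entangled: "\<rho> \<in> states \<and> deviation \<rho> = Sigma" if \<rho>: "maximally_entangled \<rho>" for \<rho>
  proof -
    obtain \<psi> where psi: "sesq \<psi> \<psi> = 1" "\<rho> = ketbra \<psi> \<psi>" and mixed: "ptrace_fst \<rho> = max_mixed"
      using \<rho> by (auto simp: maximally_entangled_def pure_state_def)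
    have "\<rho> \<in> states" using psi by (simp add: ketbra_state)
    moreover have "Sigma \<le> deviation \<rho>"
      using trace_norm_dephase_ge[OF psi(1)] mixed
      unfolding deviation_def id_tensor_measurement Sigma psi(2) by blast
    ultimately show ?thesis using upper by (simp add: antisym)
  qed
  have "Sigma = 2 * (2 ^ CARD('n) - 1) / 2 ^ CARD('n)"
    by (simp add: Sigma card_fun)
  then show ?thesis
    using Sigma upper entangled maximally_entangled_exists by blast
qed

end
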